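(* On the set of all mesh patterns of length $2$, i.e. the mesh patterns $(12,R)$ and $(21,R)$ with $R\subseteq\{0,1,2\}\times\{0,1,2\}$, the relation of Wilf-equivalence under $231$ (that is, $p_1\sim p_2$ if and only if $|\mathrm{Av}_n(\{231,p_1\})|=|\mathrm{Av}_n(\{231,p_2\})|$ for all $n\ge0$) has exactly $23$ equivalence classes.
   Context: Write $[n]=\{1,\dots,n\}$. A permutation of length $n$ is a bijection of $[n]$, written in one-line notation; $G(\pi)=\{(i,\pi(i)) : i\in[n]\}$ is its plot. A mesh pattern of length $k$ is a pair $p=(\tau,R)$ with $\tau$ a permutation of length $k$ and $R\subseteq\{0,\dots,k\}^2$. An occurrence of $p$ in a permutation $\pi$ of length $n$ is a subset $\omega\subseteq G(\pi)$ for which there are order-preserving injections $\alpha,\beta:[k]\to[n]$ such that (i) $\omega=\{(\alpha(i),\beta(j)):(i,j)\in G(\tau)\}$, and (ii) with $\alpha(0)=\beta(0)=0$, $\alpha(k+1)=\beta(k+1)=n+1$ and $R_{ij}=[\alpha(i)+1,\alpha(i+1)-1]\times[\beta(j)+1,\beta(j+1)-1]$, one has $R_{ij}\cap G(\pi)=\emptyset$ for every $(i,j)\in R$. A permutation avoids $p$ if it has no occurrence of $p$. A classical pattern $\pi$ is identified with the mesh pattern $(\pi,\emptyset)$. $\mathrm{Av}_n(S)$ is the set of all permutations of length $n$ avoiding every pattern in $S$. *)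

theory Defs
  imports "HOL-Combinatorics.Permutations"
begin

text \<open>
  A permutation of length \<open>n\<close> is a function \<open>\<pi> :: nat \<Rightarrow> nat\<close> with \<open>\<pi> permutes {1..n}\<close>. Since
  such a function is the identity outside \<open>{1..n}\<close>, equality of functions is equality of
  permutations of length \<open>n\<close>. The function alone does not determine \<open>n\<close>, so the length is carried
  along explicitly.
\<close>

definition one_line :: "nat list \<Rightarrow> nat \<Rightarrow> nat" where
  "one_line xs i = (if i \<in> {1..length xs} then xs ! (i - 1) else i)"

definition plot :: "nat \<Rightarrow> (nat \<Rightarrow> nat) \<Rightarrow> (nat \<times> nat) set" where
  "plot n \<pi> = {(i, \<pi> i) | i. i \<in> {1..n}}"

record mesh_pattern =
  plen :: nat
  pperm :: "nat \<Rightarrow> nat"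
  pmesh :: "(nat \<times> nat) set"

definition mesh_patterns :: "nat \<Rightarrow> mesh_pattern set" where
  "mesh_patterns k =
     {p. plen p = k \<and> pperm p permutes {1..k} \<and> pmesh p \<subseteq> {0..k} \<times> {0..k}}"

definition mesh_of :: "nat list \<Rightarrow> (nat \<times> nat) set \<Rightarrow> mesh_pattern" where
  "mesh_of xs R = \<lparr>plen = length xs, pperm = one_line xs, pmesh = R\<rparr>"

definition classical :: "nat list \<Rightarrow> mesh_pattern" where
  "classical xs = mesh_of xs {}"

text \<open>
  The region \<open>R\<^sub>i\<^sub>j\<close>. It is only used with \<open>\<alpha> (i + 1) \<ge> 1\<close> and \<open>\<beta> (j + 1) \<ge> 1\<close>, so the
  subtraction on natural numbers does not truncate.
\<close>

definition region :: "(nat \<Rightarrow> nat) \<Rightarrow> (nat \<Rightarrow> nat) \<Rightarrow> nat \<Rightarrow> nat \<Rightarrow> (nat \<times> nat) set" where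
  "region \<alpha> \<beta> i j = {\<alpha> i + 1..\<alpha> (i + 1) - 1} \<times> {\<beta> j + 1..\<beta> (j + 1) - 1}"

definition order_inj :: "nat \<Rightarrow> nat \<Rightarrow> (nat \<Rightarrow> nat) \<Rightarrow> bool" where
  "order_inj k n \<alpha> \<longleftrightarrow> \<alpha> ` {1..k} \<subseteq> {1..n} \<and> mono_on {1..k} \<alpha> \<and> inj_on \<alpha> {1..k}"

definition occurrence :: "mesh_pattern \<Rightarrow> nat \<Rightarrow> (nat \<Rightarrow> nat) \<Rightarrow> (nat \<times> nat) set \<Rightarrow> bool" where
  "occurrence p n \<pi> \<omega> \<longleftrightarrow> \<omega> \<subseteq> plot n \<pi> \<and>
     (\<exists>\<alpha> \<beta>. order_inj (plen p) n \<alpha> \<and> order_inj (plen p) n \<beta> \<and>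
        \<omega> = {(\<alpha> i, \<beta> j) | i j. (i, j) \<in> plot (plen p) (pperm p)} \<and>
        \<alpha> 0 = 0 \<and> \<beta> 0 = 0 \<and> \<alpha> (plen p + 1) = n + 1 \<and> \<beta> (plen p + 1) = n + 1 \<and>
        (\<forall>(i, j) \<in> pmesh p. region \<alpha> \<beta> i j \<inter> plot n \<pi> = {}))"

definition avoids :: "nat \<Rightarrow> (nat \<Rightarrow> nat) \<Rightarrow> mesh_pattern \<Rightarrow> bool" where
  "avoids n \<pi> p \<longleftrightarrow> \<not> (\<exists>\<omega>. occurrence p n \<pi> \<omega>)"

definition Av :: "nat \<Rightarrow> mesh_pattern set \<Rightarrow> (nat \<Rightarrow> nat) set" where
  "Av n S = {\<pi>. \<pi> permutes {1..n} \<and> (\<forall>p\<in>S. avoids n \<pi> p)}"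

definition wilf_under :: "mesh_pattern \<Rightarrow> mesh_pattern set \<Rightarrow> mesh_pattern rel" where
  "wilf_under q M =
     {(p1, p2). p1 \<in> M \<and> p2 \<in> M \<and> (\<forall>n. card (Av n {q, p1}) = card (Av n {q, p2}))}"

lemma equiv_wilf_under: "equiv M (wilf_under q M)"
  by (rule equivI) (auto simp: wilf_under_def refl_on_def sym_def trans_def)

lemma finite_Av: "finite (Av n S)"
  by (rule finite_subset[OF _ finite_permutations[of "{1..n}"]]) (auto simp: Av_def)

lemma one_line_12: "one_line [1, 2] = id"
proof
  fix i :: nat
  consider "i = 0" | "i = 1" | "i = 2" | "i > 2" by linarith
  then show "one_line [1, 2] i = id i" by cases (simp_all add: one_line_def)
qed

lemma one_line_21: "one_line [2, 1] = transpose 1 2"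
proof
  fix i :: nat
  consider "i = 0" | "i = 1" | "i = 2" | "i > 2" by linarith
  then show "one_line [2, 1] i = transpose 1 2 i" by cases (simp_all add: one_line_def transpose_def)
qed

lemma permutes_two_iff: "\<tau> permutes {1..2} \<longleftrightarrow> \<tau> = one_line [1, 2] \<or> \<tau> = one_line [2, 1]"
proof -
  have "{1..2} = {1, 2::nat}" by auto
  then show ?thesis by (simp only: permutes_doubleton_iff one_line_12 one_line_21)
qed

lemma mesh_patterns_two:
  "mesh_patterns 2 =
     {mesh_of xs R | xs R. xs \<in> {[1, 2], [2, 1]} \<and> R \<subseteq> {0, 1, 2} \<times> {0, 1, 2}}"
proof -
  have *: "{0..2} = {0, 1, 2::nat}" by auto
  have "p \<in> mesh_patterns 2 \<longleftrightarrow>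
    (\<exists>xs \<in> {[1, 2], [2, 1]}. \<exists>R. p = mesh_of xs R \<and> R \<subseteq> {0, 1, 2} \<times> {0, 1, 2})" for p
    unfolding mesh_patterns_def mem_Collect_eq permutes_two_iff *
    by (cases p) (auto simp: mesh_of_def simp del: One_nat_def)
  then show ?thesis by blast
qed

end

theory Submission
  imports Defs "HOL-Computational_Algebra.Formal_Power_Series"
begin

unbundle fps_syntax

text \<open>
  A \<open>231\<close>-avoiding permutation is either empty or of the form \<open>(1 \<ominus> L) \<oplus> R\<close> with \<open>L\<close>, \<open>R\<close> again
  avoiding \<open>231\<close>, so these permutations are binary trees. Whether a length-2 mesh pattern \<open>(\<tau>, R)\<close>
  occurs in \<open>(1 \<ominus> L) \<oplus> R\<close> depends only on whether it occurs in \<open>L\<close> or in \<open>R\<close> and on whether certain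
  mesh patterns of length 1 occur there. There are just seven different conditions of the latter
  kind, which leaves 130 recursive predicates in place of the 1024 patterns. For each of them the
  recursion gives an algebraic equation for the generating function of the avoiders, and solving
  these leaves 23 power series. They are pairwise distinct since the numbers of avoiders of length 3
  and 5 differ.
\<close>

section \<open>Generating functions of binary trees\<close>

text \<open>The reduction to length 1 rests on the geometry of root, \<open>L\<close> and
  \<open>R\<close>. Seen from two points inside one of the blocks \<open>L\<close>,
  \<open>R\<close>, the root and the other block each lie in a single cell, so shading asks at most
  whether a block is empty. If the two points lie in different pieces, every block without a point
  of the occurrence again falls into one cell, and a block with one point of it is cut into
  quadrants by that point alone: this is a mesh pattern of length 1. The obstacle is that the
  recursion then asks for a length-1 condition and for avoidance on the same subtree. The equation
  of the avoiders therefore involves joint series (condition and avoidance), and each of these needs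
  its own closed form or equation before it can be eliminated. Only equality of series has to be
  decided. Ten of the 23 series are kept as series of predicates and told apart by their
  coefficients; \<open>M\<close> and \<open>K\<close> are known through an equation only.\<close>

datatype btree = Lf | Nd btree btree

lemma size_eq_0_iff: "size t = 0 \<longleftrightarrow> t = Lf"
  by (cases t) auto

lemma finite_size: "finite {t :: btree. size t = n}"
proof (induction n rule: less_induct)
  case (less n)
  have "{t :: btree. size t = n} \<subseteq>
    insert Lf (\<Union>i<n. \<Union>j<n. (\<lambda>(l, r). Nd l r) ` ({t. size t = i} \<times> {t. size t = j}))"
  proof
    fix t :: btree assume t: "t \<in> {t. size t = n}"
    show "t \<in> insert Lf (\<Union>i<n. \<Union>j<n. (\<lambda>(l, r). Nd l r) ` ({t. size t = i} \<times> {t. size t = j}))"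
    proof (cases t)
      case (Nd l r)
      then have "size l < n" "size r < n" using t by auto
      then show ?thesis using Nd by force
    qed simp
  qed
  moreover have "finite (insert Lf (\<Union>i<n. \<Union>j<n.
      (\<lambda>(l, r). Nd l r) ` ({t. size t = i} \<times> {t. size t = j})))"
    using less by auto
  ultimately show ?case by (rule finite_subset)
qed

text \<open>Integer weights instead of truth values make inclusion-exclusion on predicates a matter
  of adding and subtracting series.\<close>

definition wgf :: "(btree \<Rightarrow> int) \<Rightarrow> int fps" where
  "wgf w = Abs_fps (\<lambda>n. \<Sum>t | size t = n. w t)"

definition wgf2 :: "(btree \<Rightarrow> btree \<Rightarrow> int) \<Rightarrow> int fps" where
  "wgf2 w = Abs_fps (\<lambda>n. \<Sum>(l, r) | size l + size r = n. w l r)"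

definition gf :: "(btree \<Rightarrow> bool) \<Rightarrow> int fps" where
  "gf P = wgf (\<lambda>t. of_bool (P t))"

lemma gf_nth: "gf P $ n = int (card {t. size t = n \<and> P t})"
  by (simp add: gf_def wgf_def finite_size Int_def Collect_conj_eq[symmetric] flip: of_bool_def)

lemma pairs_as_Sigma:
  "{(l, r). size l + size r = n} =
     (\<Union>i\<in>{0..n}. {l :: btree. size l = i} \<times> {r :: btree. size r = n - i})"
  by auto

lemma wgf2_mult: "wgf2 (\<lambda>l r. f l * g r) = wgf f * wgf g"
proof (rule fps_ext)
  fix n
  have "(\<Sum>(l, r) | size l + size r = n. f l * g r) =
      (\<Sum>i=0..n. \<Sum>(l, r) \<in> {l. size l = i} \<times> {r. size r = n - i}. f l * g r)"
    unfolding pairs_as_Sigma by (subst sum.UNION_disjoint) (auto simp: finite_size)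
  then show "wgf2 (\<lambda>l r. f l * g r) $ n = (wgf f * wgf g) $ n"
    by (simp add: wgf2_def wgf_def fps_mult_nth sum_product sum.cartesian_product)
qed

lemma wgf2_add: "wgf2 (\<lambda>l r. f l r + g l r) = wgf2 f + wgf2 g"
  by (rule fps_ext) (simp add: wgf2_def sum.distrib case_prod_beta)

lemma wgf2_diff: "wgf2 (\<lambda>l r. f l r - g l r) = wgf2 f - wgf2 g"
  by (rule fps_ext) (simp add: wgf2_def sum_subtractf case_prod_beta)

lemma wgf_diff: "wgf (\<lambda>t. f t - g t) = wgf f - wgf g"
  by (rule fps_ext) (simp add: wgf_def sum_subtractf)

text \<open>Deleting the root maps the trees of size \<open>m + 1\<close> bijectively to pairs of
  trees of total size \<open>m\<close>; the factor \<open>fps_X\<close> accounts for the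
  root.\<close>

lemma wgf_node: "wgf w = fps_const (w Lf) + fps_X * wgf2 (\<lambda>l r. w (Nd l r))"
proof (rule fps_ext)
  fix n
  show "wgf w $ n = (fps_const (w Lf) + fps_X * wgf2 (\<lambda>l r. w (Nd l r))) $ n"
  proof (cases n)
    case 0
    have "{t :: btree. size t = 0} = {Lf}" by (auto simp: size_eq_0_iff)
    with 0 show ?thesis by (simp add: wgf_def)
  next
    case (Suc m)
    have "{t. size t = Suc m} = (\<lambda>(l, r). Nd l r) ` {(l, r). size l + size r = m}" (is "?S = _")
    proof
      show "?S \<subseteq> (\<lambda>(l, r). Nd l r) ` {(l, r). size l + size r = m}"
      proof
        fix t assume "t \<in> ?S"
        then show "t \<in> (\<lambda>(l, r). Nd l r) ` {(l, r). size l + size r = m}"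
          by (cases t) force+
      qed
    qed auto
    then have "wgf w $ n = (\<Sum>t \<in> (\<lambda>(l, r). Nd l r) ` {(l, r). size l + size r = m}. w t)"
      using Suc by (simp only: wgf_def fps_nth_Abs_fps)
    also have "\<dots> = (\<Sum>(l, r) | size l + size r = m. w (Nd l r))"
      by (subst sum.reindex) (auto simp: inj_on_def intro!: sum.cong)
    finally show ?thesis
      using Suc by (simp add: wgf2_def)
  qed
qed

lemma gf_mult: "wgf2 (\<lambda>l r. of_bool (P l) * of_bool (Q r)) = gf P * gf Q"
  by (simp add: wgf2_mult gf_def)

lemma gf_product:
  assumes "P Lf = e" "\<And>l r. P (Nd l r) \<longleftrightarrow> Q l \<and> R r"
  shows "gf P = of_bool e + fps_X * (gf Q * gf R)"
proof -
  have "gf P = of_bool e + fps_X * wgf2 (\<lambda>l r. of_bool (Q l) * of_bool (R r))"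
    using assms by (subst gf_def, subst wgf_node) (auto simp: of_bool_conj)
  then show ?thesis by (simp add: gf_mult)
qed

lemma gf_union:
  assumes "P Lf = e" "\<And>l r. P (Nd l r) \<longleftrightarrow> Q l \<and> R r \<or> Q' l \<and> R' r"
    and "\<And>l r. \<not> (Q l \<and> R r \<and> Q' l \<and> R' r)"
  shows "gf P = of_bool e + fps_X * (gf Q * gf R + gf Q' * gf R')"
proof -
  have "of_bool (P (Nd l r)) = (of_bool (Q l) * of_bool (R r) + of_bool (Q' l) * of_bool (R' r) :: int)"
    for l r using assms(2,3)[of l r] by auto
  then have "gf P = of_bool e + fps_X *
      wgf2 (\<lambda>l r. of_bool (Q l) * of_bool (R r) + of_bool (Q' l) * of_bool (R' r))"
    using assms(1) by (subst gf_def, subst wgf_node) auto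
  then show ?thesis by (simp add: gf_mult wgf2_add)
qed

text \<open>The last two hypotheses place the excluded product inside the main one, so the
  subtraction of weights is exact. This is the shape of avoidance of \<open>12\<close>: the subtrees
  avoid separately, minus the pairs that create an occurrence across the root split.\<close>

lemma gf_except:
  assumes "P Lf = e" "\<And>l r. P (Nd l r) \<longleftrightarrow> Q l \<and> R r \<and> \<not> (Q' l \<and> R' r)"
    and "\<And>t. Q' t \<Longrightarrow> Q t" "\<And>t. R' t \<Longrightarrow> R t"
  shows "gf P = of_bool e + fps_X * (gf Q * gf R - gf Q' * gf R')"
proof -
  have "of_bool (P (Nd l r)) = (of_bool (Q l) * of_bool (R r) - of_bool (Q' l) * of_bool (R' r) :: int)"
    for l r using assms(2)[of l r] assms(3)[of l] assms(4)[of r] by auto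
  then have "gf P = of_bool e + fps_X *
      wgf2 (\<lambda>l r. of_bool (Q l) * of_bool (R r) - of_bool (Q' l) * of_bool (R' r))"
    using assms(1) by (subst gf_def, subst wgf_node) auto
  then show ?thesis by (simp add: gf_mult wgf2_diff)
qed

lemma gf_diff: "gf (\<lambda>t. P t \<and> \<not> Q t) = gf P - gf (\<lambda>t. Q t \<and> P t)"
proof -
  have "of_bool (P t \<and> \<not> Q t) = (of_bool (P t) - of_bool (Q t \<and> P t) :: int)" for t by auto
  then show ?thesis by (simp add: gf_def wgf_diff)
qed

lemma gf_eq_Lf [simp]: "gf (\<lambda>t. t = Lf) = 1"
  by (subst gf_def, subst wgf_node) (simp add: wgf2_def fps_eq_iff)

lemma gf_neq_Lf: "gf (\<lambda>t. t \<noteq> Lf \<and> P t) = gf P - of_bool (P Lf)"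
proof -
  have "of_bool (t \<noteq> Lf \<and> P t) = (of_bool (P t) - of_bool (t = Lf \<and> P Lf) :: int)" for t by auto
  then have "gf (\<lambda>t. t \<noteq> Lf \<and> P t) = gf P - gf (\<lambda>t. t = Lf \<and> P Lf)"
    by (simp add: gf_def wgf_diff)
  moreover have "gf (\<lambda>t. False) = 0" by (simp add: fps_eq_iff gf_nth)
  ultimately show ?thesis by (cases "P Lf") auto
qed

text \<open>Integer power series form an integral domain. Equality is stated as a vanishing product
  because \<open>algebra\<close> proves ideal membership and cannot divide; the constant term shows
  at a glance that \<open>u\<close> is nonzero.\<close>

lemma fps_cancel:
  fixes f g u :: "int fps"
  assumes "u * (f - g) = 0" "u $ 0 \<noteq> 0"
  shows "f = g"
  using assms by auto

section \<open>Recursive predicates for avoidance\<close>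

text \<open>
  The tree \<open>Nd l r\<close> stands for \<open>(1 \<ominus> l) \<oplus> r\<close>; the left subtrees along its right
  spine are the sum components, each without its first point.
\<close>

fun indec :: "btree \<Rightarrow> bool" where
  "indec Lf \<longleftrightarrow> False"
| "indec (Nd l r) \<longleftrightarrow> r = Lf"

fun chain :: "btree \<Rightarrow> bool" where
  "chain Lf \<longleftrightarrow> True"
| "chain (Nd l r) \<longleftrightarrow> r = Lf \<and> chain l"

fun has_trivial :: "btree \<Rightarrow> bool" where
  "has_trivial Lf \<longleftrightarrow> False"
| "has_trivial (Nd l r) \<longleftrightarrow> l = Lf \<or> has_trivial r"

fun first_trivial :: "btree \<Rightarrow> bool" where
  "first_trivial Lf \<longleftrightarrow> False"
| "first_trivial (Nd l r) \<longleftrightarrow> l = Lf"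

fun last_trivial :: "btree \<Rightarrow> bool" where
  "last_trivial Lf \<longleftrightarrow> False"
| "last_trivial (Nd l r) \<longleftrightarrow> l = Lf \<and> r = Lf \<or> last_trivial r"

abbreviation any :: "btree \<Rightarrow> bool" where "any \<equiv> \<lambda>t. True"
abbreviation empty :: "btree \<Rightarrow> bool" where "empty \<equiv> \<lambda>t. t = Lf"
abbreviation nonempty :: "btree \<Rightarrow> bool" where "nonempty \<equiv> \<lambda>t. t \<noteq> Lf"
abbreviation nechain :: "btree \<Rightarrow> bool" where "nechain \<equiv> \<lambda>t. t \<noteq> Lf \<and> chain t"
abbreviation single :: "btree \<Rightarrow> bool" where "single \<equiv> \<lambda>t. t = Nd Lf Lf"

text \<open>
  The parameters \<open>a\<close>, \<open>b\<close>, \<open>d\<close> tell whether the cells \<open>(0, 2)\<close>, \<open>(2, 2)\<close>, \<open>(0, 0)\<close> are shaded. In the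
  last disjunct the larger point of the occurrence of \<open>12\<close> is in \<open>r\<close> and the smaller one is not; in
  that of \<open>21\<close> the larger point is the root and the smaller one is in \<open>l\<close>. The letters in names such
  as \<open>V12_TFF\<close> are the values of \<open>a\<close>, \<open>b\<close>, \<open>d\<close>.
\<close>

fun contains12 :: "bool \<Rightarrow> bool \<Rightarrow> bool \<Rightarrow> (btree \<Rightarrow> bool) \<Rightarrow> (btree \<Rightarrow> bool) \<Rightarrow> btree \<Rightarrow> bool" where
  "contains12 a b d Y E Lf \<longleftrightarrow> False"
| "contains12 a b d Y E (Nd l r) \<longleftrightarrow>
     \<not> a \<and> (b \<longrightarrow> r = Lf) \<and> contains12 a b d Y E l \<or> \<not> d \<and> contains12 a b d Y E r \<or> Y r \<and> E l"

fun contains21 :: "bool \<Rightarrow> bool \<Rightarrow> bool \<Rightarrow> (btree \<Rightarrow> bool) \<Rightarrow> btree \<Rightarrow> bool" where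
  "contains21 a b d Z Lf \<longleftrightarrow> False"
| "contains21 a b d Z (Nd l r) \<longleftrightarrow>
     \<not> a \<and> (b \<longrightarrow> r = Lf) \<and> contains21 a b d Z l \<or> \<not> d \<and> contains21 a b d Z r \<or> (b \<longrightarrow> r = Lf) \<and> Z l"

definition V12 :: "bool \<Rightarrow> bool \<Rightarrow> bool \<Rightarrow> (btree \<Rightarrow> bool) \<Rightarrow> (btree \<Rightarrow> bool) \<Rightarrow> int fps" where
  "V12 a b d Y E = gf (\<lambda>t. \<not> contains12 a b d Y E t)"

definition V21 :: "bool \<Rightarrow> bool \<Rightarrow> bool \<Rightarrow> (btree \<Rightarrow> bool) \<Rightarrow> int fps" where
  "V21 a b d Z = gf (\<lambda>t. \<not> contains21 a b d Z t)"

abbreviation X :: "int fps" where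
  "X \<equiv> fps_X"

text \<open>\<open>C\<close> is the Catalan series, \<open>D\<close> is \<open>1 / (1 - X)\<close>,
  and \<open>C - H\<close> is the series of the Fine numbers 1, 0, 1, 2, 6, 18, ...\<close>

definition C :: "int fps" where "C = gf (\<lambda>t. True)"
definition D :: "int fps" where "D = gf chain"
definition H :: "int fps" where "H = gf has_trivial"

lemma C_eq: "C = 1 + X * (C * C)"
  unfolding C_def by (subst gf_product[where e = True]) auto

lemma D_eq: "D = 1 + X * D"
  unfolding D_def
  by (subst gf_product[where e = True and Q = chain and R = "\<lambda>t. t = Lf"]) auto

lemma H_eq: "H = X * (C + (C - 1) * H)"
  unfolding H_def C_def
  using gf_union[of has_trivial False "\<lambda>t. t = Lf" "\<lambda>t. True" "\<lambda>t. t \<noteq> Lf" has_trivial]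
    gf_neq_Lf[of "\<lambda>t. True"]
  by auto

lemma gf_nonempty: "gf (\<lambda>t. t \<noteq> Lf) = C - 1"
  using gf_neq_Lf[of "\<lambda>t. True"] by (simp add: C_def)

lemma gf_indec: "gf indec = X * C"
  by (subst gf_product[where e = False and Q = "\<lambda>t. True" and R = "\<lambda>t. t = Lf"]) (auto simp: C_def)

lemma gf_chain: "gf (\<lambda>t. t \<noteq> Lf \<and> chain t) = X * D"
proof -
  have "gf (\<lambda>t. t \<noteq> Lf \<and> chain t) = D - 1"
    by (simp add: gf_neq_Lf D_def)
  then show ?thesis using D_eq by algebra
qed

lemma gf_not: "gf (\<lambda>t. \<not> P t) = C - gf P"
  using gf_diff[of "\<lambda>t. True" P] by (simp add: C_def)

lemma gf_first: "gf first_trivial = X * C"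
  by (subst gf_product[where e = False and Q = "\<lambda>t. t = Lf" and R = "\<lambda>t. True"]) (auto simp: C_def)

lemma last_trivial_nonempty [simp]: "last_trivial t \<Longrightarrow> t \<noteq> Lf"
  by (cases t) auto

lemma gf_last: "gf last_trivial = X * C"
proof -
  have "gf last_trivial = X * (1 + C * gf last_trivial)"
    using gf_union[of last_trivial False "\<lambda>t. t = Lf" "\<lambda>t. t = Lf" "\<lambda>t. True" last_trivial]
    by (auto simp: C_def)
  \<comment> \<open>\<open>X * C\<close> solves the same linear equation because
    \<open>C * (1 - X * C) = 1\<close>.\<close>
  then have "(1 - X * C) * (gf last_trivial - X * C) = 0"
    using C_eq by algebra
  then show ?thesis by (rule fps_cancel) simp
qed

lemma gf_single: "gf (\<lambda>t. t = Nd Lf Lf) = X"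
  by (subst gf_product[where e = False and Q = "\<lambda>t. t = Lf" and R = "\<lambda>t. t = Lf"]) auto

section \<open>Functional equations for the avoiders, by the shading of three corner cells\<close>

lemma V12_TFT:
  shows "V12 True False True Y E = C - X * (gf E * gf Y)"
  unfolding V12_def
  by (subst gf_except[where e = True and Q = "\<lambda>t. True" and R = "\<lambda>t. True" and Q' = E and R' = Y])
    (use C_eq in \<open>auto simp: C_def algebra_simps\<close>)

text \<open>A subtree in which occurrences still count must itself avoid. So
  \<open>d = False\<close> pairs \<open>Y\<close> with avoidance in the right subtree, and likewise
  \<open>a = False\<close> pairs \<open>E\<close> with avoidance in the left one; these are the
  joint series.\<close>

lemma V12_TFF:
  shows "V12 True False False Y E = 1 + X * (C * V12 True False False Y E
     - gf E * gf (\<lambda>t. Y t \<and> \<not> contains12 True False False Y E t))"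
  unfolding V12_def C_def
  by (subst gf_except[where e = True and Q = "\<lambda>t. True" and Q' = E and
        R = "\<lambda>t. \<not> contains12 True False False Y E t" and R' = "\<lambda>t. Y t \<and> \<not> contains12 True False False Y E t"]) auto

lemma V12_FFT:
  shows "V12 False False True Y E = 1 + X * (V12 False False True Y E * C
     - gf (\<lambda>t. E t \<and> \<not> contains12 False False True Y E t) * gf Y)"
  unfolding V12_def C_def
  by (subst gf_except[where e = True and R = "\<lambda>t. True" and R' = Y and
        Q = "\<lambda>t. \<not> contains12 False False True Y E t" and Q' = "\<lambda>t. E t \<and> \<not> contains12 False False True Y E t"]) auto

lemma V12_FFF:
  shows "V12 False False False Y E = 1 + X * (V12 False False False Y E * V12 False False False Y E
     - gf (\<lambda>t. E t \<and> \<not> contains12 False False False Y E t) * gf (\<lambda>t. Y t \<and> \<not> contains12 False False False Y E t))"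
  unfolding V12_def C_def
  by (subst gf_except[where e = True and R = "\<lambda>t. \<not> contains12 False False False Y E t"
        and R' = "\<lambda>t. Y t \<and> \<not> contains12 False False False Y E t" and
        Q = "\<lambda>t. \<not> contains12 False False False Y E t" and Q' = "\<lambda>t. E t \<and> \<not> contains12 False False False Y E t"]) auto

text \<open>If the root has a right subtree, then with the cell \<open>(2, 2)\<close> shaded no occurrence lies in the left subtree.\<close>

lemma gf_split_right:
  assumes "P Lf = e" "\<And>l r. P (Nd l r) \<longleftrightarrow> (if r = Lf then Q l else S r \<and> \<not> (Q' l \<and> R' r))"
    and "S Lf" "\<not> R' Lf" "\<And>t. R' t \<Longrightarrow> S t"
  shows "gf P = of_bool e + X * (gf Q + C * (gf S - 1) - gf Q' * gf R')"
proof -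
  have "of_bool (P (Nd l r)) = (of_bool (Q l) * of_bool (r = Lf)
      + of_bool True * of_bool (r \<noteq> Lf \<and> S r) - of_bool (Q' l) * of_bool (R' r) :: int)"
    for l r using assms(2)[of l r] assms(3,4) assms(5)[of r] by (cases "r = Lf") auto
  then have "gf P = of_bool e + X *
      wgf2 (\<lambda>l r. of_bool (Q l) * of_bool (r = Lf)
      + of_bool True * of_bool (r \<noteq> Lf \<and> S r) - of_bool (Q' l) * of_bool (R' r))"
    using assms(1) by (subst gf_def, subst wgf_node) auto
  then show ?thesis using assms(3)
    by (simp only: gf_mult wgf2_diff wgf2_add gf_eq_Lf gf_neq_Lf C_def) simp
qed

lemma V12_FTT:
  assumes "\<not> Y Lf"
  shows "V12 False True True Y E = 1 + X * (V12 False True True Y E + C * (C - 1) - gf E * gf Y)"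
  unfolding V12_def
  by (subst gf_split_right[where e = True and S = "\<lambda>t. True" and Q' = E and R' = Y and
        Q = "\<lambda>t. \<not> contains12 False True True Y E t"])
    (use assms in \<open>auto simp: C_def\<close>)

lemma V12_FTF:
  assumes "\<not> Y Lf"
  shows "V12 False True False Y E = 1 + X * (V12 False True False Y E
    + C * (V12 False True False Y E - 1) - gf E * gf (\<lambda>t. Y t \<and> \<not> contains12 False True False Y E t))"
  unfolding V12_def
  by (subst gf_split_right[where e = True and S = "\<lambda>t. \<not> contains12 False True False Y E t" and Q' = E and
        R' = "\<lambda>t. Y t \<and> \<not> contains12 False True False Y E t" and
        Q = "\<lambda>t. \<not> contains12 False True False Y E t"])
    (use assms in \<open>auto simp: C_def\<close>)

text \<open>The two points of an occurrence of \<open>21\<close> never straddle the summands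
  \<open>1 \<ominus> l\<close> and \<open>r\<close>. With \<open>(2, 2)\<close> unshaded the
  condition for one using the root concerns \<open>l\<close> alone, so avoidance is a
  product.\<close>

lemma V21_TFT: "V21 True False True Z = 1 + X * ((C - gf Z) * C)"
  unfolding V21_def
  by (subst gf_product[where e = True and Q = "\<lambda>t. \<not> Z t" and R = "\<lambda>t. True"])
    (auto simp: gf_not simp flip: C_def)

lemma V21_TFF: "V21 True False False Z = 1 + X * ((C - gf Z) * V21 True False False Z)"
  unfolding V21_def
  by (subst gf_product[where e = True and Q = "\<lambda>t. \<not> Z t" and R = "\<lambda>t. \<not> contains21 True False False Z t"])
    (auto simp: gf_not simp flip: C_def)

lemma V21_FFT: "V21 False False True Z = 1 + X *
    ((V21 False False True Z - gf (\<lambda>t. Z t \<and> \<not> contains21 False False True Z t)) * C)"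
  unfolding V21_def
  by (subst gf_product[where e = True and Q = "\<lambda>t. \<not> contains21 False False True Z t \<and> \<not> Z t" and R = "\<lambda>t. True"])
    (use gf_diff[of "\<lambda>t. \<not> contains21 False False True Z t" Z] in \<open>auto simp: C_def\<close>)

lemma V21_FFF: "V21 False False False Z = 1 + X *
    ((V21 False False False Z - gf (\<lambda>t. Z t \<and> \<not> contains21 False False False Z t)) * V21 False False False Z)"
  unfolding V21_def
  by (subst gf_product[where e = True and Q = "\<lambda>t. \<not> contains21 False False False Z t \<and> \<not> Z t" and
       R = "\<lambda>t. \<not> contains21 False False False Z t"])
    (use gf_diff[of "\<lambda>t. \<not> contains21 False False False Z t" Z] in \<open>auto simp: C_def\<close>)

lemma gf_False [simp]: "gf (\<lambda>t. False) = 0"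
  by (simp add: fps_eq_iff gf_nth)

lemma V21_TTT: "V21 True True True Z = C - X * gf Z"
  unfolding V21_def
  \<comment> \<open>\<open>R'\<close> is constantly false: once the right subtree is nonempty, the
    shaded cell \<open>(2, 2)\<close> also rules out occurrences that use the root, and nothing is
    subtracted.\<close>
  by (subst gf_split_right[where e = True and Q = "\<lambda>t. \<not> Z t" and S = "\<lambda>t. True" and R' = "\<lambda>t. False"])
    (use C_eq in \<open>auto simp: gf_not algebra_simps simp flip: C_def\<close>)

lemma V21_TTF: "V21 True True False Z = 1 + X * (C * V21 True True False Z - gf Z)"
  unfolding V21_def
  by (subst gf_split_right[where e = True and Q = "\<lambda>t. \<not> Z t" and
        S = "\<lambda>t. \<not> contains21 True True False Z t" and R' = "\<lambda>t. False"])
    (auto simp: gf_not algebra_simps)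

lemma V21_FTT: "V21 False True True Z = 1 + X * (V21 False True True Z
    - gf (\<lambda>t. Z t \<and> \<not> contains21 False True True Z t) + C * (C - 1))"
  unfolding V21_def
  by (subst gf_split_right[where e = True and Q = "\<lambda>t. \<not> contains21 False True True Z t \<and> \<not> Z t" and
        S = "\<lambda>t. True" and R' = "\<lambda>t. False"])
    (use gf_diff[of "\<lambda>t. \<not> contains21 False True True Z t" Z] in \<open>auto simp: C_def\<close>)

lemma V21_FTF: "V21 False True False Z = 1 + X * (V21 False True False Z
    - gf (\<lambda>t. Z t \<and> \<not> contains21 False True False Z t) + C * (V21 False True False Z - 1))"
  unfolding V21_def
  by (subst gf_split_right[where e = True and Q = "\<lambda>t. \<not> contains21 False True False Z t \<and> \<not> Z t" and
        S = "\<lambda>t. \<not> contains21 False True False Z t" and R' = "\<lambda>t. False"])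
    (use gf_diff[of "\<lambda>t. \<not> contains21 False True False Z t" Z] in \<open>auto simp: C_def\<close>)

section \<open>Joint series: a condition of length 1 together with avoidance\<close>

lemma chain_avoids12:
  assumes "\<not> Y Lf" "chain t"
  shows "\<not> contains12 a b d Y E t"
  using assms(2) by (induction t) (use assms(1) in auto)

text \<open>In \<open>contains12\<close> the parameter \<open>b\<close> guards only the recursion
  into the left subtree, which \<open>a\<close> switches off. For \<open>contains21\<close> it also
  guards the case of the root, so TT and TF stay apart there.\<close>

lemma V12_unrestricted: "V12 True b d Y E = V12 True False d Y E"
proof -
  have "contains12 True b d Y E t = contains12 True False d Y E t" for t
    by (induction t) auto
  then show ?thesis by (simp add: V12_def)
qed

lemma joint12_nonempty: "gf (\<lambda>t. t \<noteq> Lf \<and> \<not> contains12 a b d Y E t) = V12 a b d Y E - 1"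
  by (simp add: gf_neq_Lf V12_def)

lemma joint12_empty: "gf (\<lambda>t. t = Lf \<and> \<not> contains12 a b d Y E t) = 1"
proof -
  have "(\<lambda>t. t = Lf \<and> \<not> contains12 a b d Y E t) = empty" by auto
  then show ?thesis by simp
qed

lemma joint12_chain:
  assumes "\<not> Y Lf"
  shows "gf (\<lambda>t. chain t \<and> \<not> contains12 a b d Y E t) = D"
proof -
  have "(\<lambda>t. chain t \<and> \<not> contains12 a b d Y E t) = chain"
    using chain_avoids12[of Y] assms by auto
  then show ?thesis by (simp add: D_def)
qed

lemma joint12_nechain:
  "gf (\<lambda>t. (t \<noteq> Lf \<and> chain t) \<and> \<not> contains12 a b d nechain E t) = X * D"
proof -
  have "(\<lambda>t. (t \<noteq> Lf \<and> chain t) \<and> \<not> contains12 a b d nechain E t) = nechain"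
    using chain_avoids12[of nechain] by auto
  then show ?thesis by (simp only: gf_chain)
qed

lemma joint12_single: "gf (\<lambda>t. t = Nd Lf Lf \<and> \<not> contains12 a b d single E t) = X"
proof -
  have "(\<lambda>t. t = Nd Lf Lf \<and> \<not> contains12 a b d single E t) = single" by auto
  then show ?thesis by (simp only: gf_single)
qed

text \<open>An \<open>indec\<close> tree has \<open>r = Lf\<close>, where the condition on
  \<open>r\<close> fails; only an occurrence within \<open>l\<close> could remain, and
  \<open>a\<close> forbids it.\<close>

lemma joint12_indec_T: "gf (\<lambda>t. indec t \<and> \<not> contains12 True b d indec E t) = X * C"
  by (subst gf_product[where e = False and Q = any and R = empty]) (auto simp: C_def)

lemma joint12_indec_FT:
  "gf (\<lambda>t. indec t \<and> \<not> contains12 False b d indec E t) = X * V12 False b d indec E"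
  by (subst gf_product[where e = False and R = empty and
        Q = "\<lambda>t. \<not> contains12 False b d indec E t"]) (auto simp: V12_def)

lemma joint12_first:
  "gf (\<lambda>t. first_trivial t \<and> \<not> contains12 a False False first_trivial any t) =
    X * (V12 a False False first_trivial any
      - gf (\<lambda>t. first_trivial t \<and> \<not> contains12 a False False first_trivial any t))"
  by (subst gf_product[where e = False and Q = empty and
        R = "\<lambda>t. \<not> contains12 a False False first_trivial any t \<and> \<not> first_trivial t"])
     (auto simp: V12_def gf_diff)

text \<open>With \<open>E = any\<close>, avoidance forbids a trivial component in \<open>r\<close>;
  so the trivial component must be the root itself and \<open>l = Lf\<close>. This gives the same
  equation as for \<open>first_trivial\<close>.\<close>

lemma joint12_has:
  "gf (\<lambda>t. has_trivial t \<and> \<not> contains12 a False False has_trivial any t) =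
    X * (V12 a False False has_trivial any
      - gf (\<lambda>t. has_trivial t \<and> \<not> contains12 a False False has_trivial any t))"
  by (subst gf_product[where e = False and Q = empty and
        R = "\<lambda>t. \<not> contains12 a False False has_trivial any t \<and> \<not> has_trivial t"])
     (auto simp: V12_def gf_diff)

text \<open>If \<open>r\<close> is nonempty, then \<open>last_trivial\<close> is inherited by
  \<open>r\<close> and creates an occurrence at the root. Only the one-node tree survives.\<close>

lemma joint12_last_any: "gf (\<lambda>t. last_trivial t \<and> \<not> contains12 a b False last_trivial any t) = X"
  by (subst gf_product[where e = False and Q = empty and R = empty]) auto

text \<open>If \<open>l = Lf\<close>, avoidance excludes \<open>last_trivial r\<close>, which leaves
  \<open>r = Lf\<close>. Otherwise \<open>r\<close> is nonempty, and either \<open>a\<close> or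
  \<open>b\<close> makes occurrences in \<open>l\<close> harmless; hence the factor
  \<open>C - 1\<close>.\<close>

lemma joint12_last_empty:
  assumes "a \<or> b"
  shows "gf (\<lambda>t. last_trivial t \<and> \<not> contains12 a b False last_trivial empty t) =
    X * (1 + (C - 1) * gf (\<lambda>t. last_trivial t \<and> \<not> contains12 a b False last_trivial empty t))"
  by (subst gf_union[where e = False and Q = empty and R = empty and Q' = nonempty and
      R' = "\<lambda>t. last_trivial t \<and> \<not> contains12 a b False last_trivial empty t"])
    (use assms in \<open>auto simp: gf_nonempty\<close>)

lemma joint21_nonempty: "gf (\<lambda>t. t \<noteq> Lf \<and> \<not> contains21 a b d Z t) = V21 a b d Z - 1"
  by (simp add: gf_neq_Lf V21_def)

lemma joint21_single: "gf (\<lambda>t. t = Nd Lf Lf \<and> \<not> contains21 a b d single t) = X"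
proof -
  have "(\<lambda>t. t = Nd Lf Lf \<and> \<not> contains21 a b d single t) = single" by auto
  then show ?thesis by (simp only: gf_single)
qed

text \<open>In a chain with at least two nodes the left subtree is again a nonempty chain, which is
  an occurrence at the root.\<close>

lemma joint21_nechain:
  "gf (\<lambda>t. (t \<noteq> Lf \<and> chain t) \<and> \<not> contains21 a b d nechain t) = X"
proof -
  have "(t \<noteq> Lf \<and> chain t) \<and> \<not> contains21 a b d nechain t \<longleftrightarrow> t = Nd Lf Lf" for t
    by (cases t) auto
  then show ?thesis by (simp only: gf_single)
qed

lemma joint21_indec:
  "gf (\<lambda>t. indec t \<and> \<not> contains21 False b d indec t) =
    X * (V21 False b d indec - gf (\<lambda>t. indec t \<and> \<not> contains21 False b d indec t))"
  by (subst gf_product[where e = False and R = empty and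
        Q = "\<lambda>t. \<not> contains21 False b d indec t \<and> \<not> indec t"])
     (auto simp: V21_def gf_diff)

lemma joint21_first_T:
  "gf (\<lambda>t. first_trivial t \<and> \<not> contains21 a b True first_trivial t) = X * C"
  by (subst gf_product[where e = False and Q = empty and R = any]) (auto simp: C_def)

lemma joint21_first_F:
  "gf (\<lambda>t. first_trivial t \<and> \<not> contains21 a b False first_trivial t) = X * V21 a b False first_trivial"
  by (subst gf_product[where e = False and Q = empty and
      R = "\<lambda>t. \<not> contains21 a b False first_trivial t"]) (auto simp: V21_def)

text \<open>Splitting on \<open>l = Lf\<close> makes the two cases disjoint. In the second,
  \<open>l\<close> avoids, has no trivial component and is nonempty; the empty tree meets the first
  two demands, whence the \<open>- 1\<close>.\<close>

lemma joint21_has_FFT: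
  defines "U \<equiv> gf (\<lambda>t. has_trivial t \<and> \<not> contains21 False False True has_trivial t)"
  shows "U = X * (C + (V21 False False True has_trivial - U - 1) * H)"
proof -
  have "U = X * (C + gf (\<lambda>t. t \<noteq> Lf \<and> (\<not> contains21 False False True has_trivial t \<and> \<not> has_trivial t)) * H)"
    unfolding U_def
    by (subst gf_union[where e = False and Q = empty and R = any and R' = has_trivial and
          Q' = "\<lambda>t. t \<noteq> Lf \<and> (\<not> contains21 False False True has_trivial t \<and> \<not> has_trivial t)"])
      (auto simp: C_def H_def)
  then show ?thesis by (simp add: gf_neq_Lf gf_diff U_def V21_def)
qed

lemma joint21_has_FFF:
  defines "U \<equiv> gf (\<lambda>t. has_trivial t \<and> \<not> contains21 False False False has_trivial t)"
    and "V \<equiv> V21 False False False has_trivial"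
  shows "U = X * (V + (V - U - 1) * U)"
proof -
  have "U = X * (V + gf (\<lambda>t. t \<noteq> Lf \<and> (\<not> contains21 False False False has_trivial t \<and> \<not> has_trivial t)) * U)"
    unfolding U_def V_def
    by (subst gf_union[where e = False and Q = empty and R = "\<lambda>t. \<not> contains21 False False False has_trivial t"
          and R' = "\<lambda>t. has_trivial t \<and> \<not> contains21 False False False has_trivial t" and
          Q' = "\<lambda>t. t \<noteq> Lf \<and> (\<not> contains21 False False False has_trivial t \<and> \<not> has_trivial t)"])
      (auto simp: V21_def)
  then show ?thesis by (simp add: gf_neq_Lf gf_diff U_def V21_def V_def)
qed

text \<open>If \<open>l\<close> is nonempty, the trivial component lies in \<open>r\<close>; then
  \<open>(2, 2)\<close> is hit and \<open>l\<close> may be any nonempty tree.\<close>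

lemma joint21_has_FTF:
  defines "U \<equiv> gf (\<lambda>t. has_trivial t \<and> \<not> contains21 False True False has_trivial t)"
    and "V \<equiv> V21 False True False has_trivial"
  shows "U = X * (V + (C - 1) * U)"
  unfolding U_def V_def
  by (subst gf_union[where e = False and Q = empty and R = "\<lambda>t. \<not> contains21 False True False has_trivial t"
        and R' = "\<lambda>t. has_trivial t \<and> \<not> contains21 False True False has_trivial t" and Q' = nonempty])
    (auto simp: V21_def gf_nonempty)

lemma joint21_last_FFT:
  defines "U \<equiv> gf (\<lambda>t. last_trivial t \<and> \<not> contains21 False False True last_trivial t)"
  shows "U = X * (1 + (V21 False False True last_trivial - U) * (X * C))"
  unfolding U_def
  by (subst gf_union[where e = False and Q = empty and R = empty and R' = last_trivial and
        Q' = "\<lambda>t. \<not> contains21 False False True last_trivial t \<and> \<not> last_trivial t"])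
    (auto simp: gf_diff V21_def gf_last)

lemma joint21_last_FFF:
  defines "U \<equiv> gf (\<lambda>t. last_trivial t \<and> \<not> contains21 False False False last_trivial t)"
  shows "U = X * (1 + (V21 False False False last_trivial - U) * U)"
  unfolding U_def
  by (subst gf_union[where e = False and Q = empty and R = empty and
        R' = "\<lambda>t. last_trivial t \<and> \<not> contains21 False False False last_trivial t" and
        Q' = "\<lambda>t. \<not> contains21 False False False last_trivial t \<and> \<not> last_trivial t"])
    (auto simp: gf_diff V21_def)

text \<open>A \<open>last_trivial\<close> tree with more than one node has a nonempty right subtree.
  With \<open>b\<close> and \<open>d\<close> shaded it then has no occurrence at all.\<close>

lemma joint21_last_FTT:
  "gf (\<lambda>t. last_trivial t \<and> \<not> contains21 False True True last_trivial t) = X * C"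
proof -
  have "last_trivial t \<and> \<not> contains21 False True True last_trivial t \<longleftrightarrow> last_trivial t" for t
    by (cases t) auto
  then show ?thesis by (simp only: gf_last)
qed

lemma joint21_last_FTF:
  defines "U \<equiv> gf (\<lambda>t. last_trivial t \<and> \<not> contains21 False True False last_trivial t)"
  shows "U = X * (1 + C * U)"
  unfolding U_def
  by (subst gf_union[where e = False and Q = empty and R = empty and Q' = any and
        R' = "\<lambda>t. last_trivial t \<and> \<not> contains21 False True False last_trivial t"])
    (auto simp: C_def)

text \<open>Turns an instance of a functional equation into a polynomial relation between series.
  Joint lemmas whose right-hand side contains the same joint series would loop as rewrite rules;
  they are passed to \<open>algebra\<close> as equations instead.\<close>

lemmas gf_simps = simp_thms True_implies_equals C_def[symmetric] D_def[symmetric] H_def[symmetric]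
  V12_def[symmetric] V21_def[symmetric] gf_eq_Lf
  gf_nonempty gf_indec gf_chain gf_first gf_last gf_single
  joint12_nonempty joint12_empty joint12_chain joint12_nechain joint12_single
  joint12_indec_T joint12_indec_FT joint12_last_any
  joint21_nonempty joint21_single joint21_nechain joint21_first_T joint21_first_F joint21_last_FTT
  btree.distinct indec.simps(1) has_trivial.simps(1) first_trivial.simps(1) last_trivial.simps(1)

section \<open>Solving the equations\<close>

text \<open>
  Eliminating the auxiliary series leaves an equation for \<open>V\<close> that is affine or quadratic. The proofs
  cancel the coefficient of \<open>V\<close>, or that of the difference of two solutions, whose constant term is
  nonzero.
\<close>

definition M :: "int fps" where
  "M = V12 False False False nonempty empty"

text \<open>Writing \<open>M = 1 + X * m\<close> turns this into
  \<open>m = 1 + X m + X^2 m^2\<close>, the equation of the Motzkin series.\<close>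

lemma M_eq: "M = 1 + X * (M * M - (M - 1))"
  using V12_FFF[of nonempty empty, simplified gf_simps] by (simp add: M_def)

definition K :: "int fps" where
  "K = V21 True False False indec"

text \<open>Since \<open>C (1 - X C) = 1\<close>, this says \<open>K = C / (1 + X (C - 1))\<close>;
  the linear equation stands in for that quotient.\<close>

lemma K_eq: "(1 - X * C + X * X * C) * K = 1"
  using V21_TFF[of indec, simplified gf_simps] unfolding K_def by algebra

lemmas base_eqs = C_eq D_eq H_eq

text \<open>The rules normalise a series to the representative of its class. The combinations of
  parameters are those that come from a mesh: \<open>b\<close> is at the same time the upper right
  quadrant of \<open>Y\<close>, and \<open>E = chain\<close> arises only with
  \<open>d\<close>.\<close>

named_theorems class_gf

lemma V12_TFT_nonempty_any [class_gf]: "V12 True False True nonempty any = 1 + X * C"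
  by (rule fps_cancel[of "1"])
    (use V12_TFT[of nonempty any, simplified gf_simps] base_eqs in algebra, simp)

lemma V12_TFT_nonempty_chain [class_gf]: "V12 True False True nonempty chain = C - X * (C - 1) * D"
  by (rule fps_cancel[of "1"])
    (use V12_TFT[of nonempty chain, simplified gf_simps] base_eqs in algebra, simp)

lemma V12_TFT_nonempty_empty [class_gf]: "V12 True False True nonempty empty = C - X * (C - 1)"
  by (rule fps_cancel[of "1"])
    (use V12_TFT[of nonempty empty, simplified gf_simps] base_eqs in algebra, simp)

lemma V12_TFT_indec_any [class_gf]: "V12 True False True indec any = C - X * (C - 1)"
  by (rule fps_cancel[of "1"])
    (use V12_TFT[of indec any, simplified gf_simps] base_eqs in algebra, simp)

lemma V12_TFT_last_any [class_gf]: "V12 True False True last_trivial any = C - X * (C - 1)"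
  by (rule fps_cancel[of "1"])
    (use V12_TFT[of last_trivial any, simplified gf_simps] base_eqs in algebra, simp)

lemma V12_TFT_first_any [class_gf]: "V12 True False True first_trivial any = C - X * (C - 1)"
  by (rule fps_cancel[of "1"])
    (use V12_TFT[of first_trivial any, simplified gf_simps] base_eqs in algebra, simp)

lemma V12_TFT_indec_chain [class_gf]: "V12 True False True indec chain = C - X * X * C * D"
  by (rule fps_cancel[of "1"])
    (use V12_TFT[of indec chain, simplified gf_simps] base_eqs in algebra, simp)

lemma V12_TFT_first_chain [class_gf]: "V12 True False True first_trivial chain = C - X * X * C * D"
  by (rule fps_cancel[of "1"])
    (use V12_TFT[of first_trivial chain, simplified gf_simps] base_eqs in algebra, simp)

lemma V12_TFT_indec_empty [class_gf]: "V12 True False True indec empty = C - X * X * C"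
  by (rule fps_cancel[of "1"])
    (use V12_TFT[of indec empty, simplified gf_simps] base_eqs in algebra, simp)

lemma V12_TFT_last_empty [class_gf]: "V12 True False True last_trivial empty = C - X * X * C"
  by (rule fps_cancel[of "1"])
    (use V12_TFT[of last_trivial empty, simplified gf_simps] base_eqs in algebra, simp)

lemma V12_TFT_first_empty [class_gf]: "V12 True False True first_trivial empty = C - X * X * C"
  by (rule fps_cancel[of "1"])
    (use V12_TFT[of first_trivial empty, simplified gf_simps] base_eqs in algebra, simp)

lemma V12_TFT_has_any [class_gf]: "V12 True False True has_trivial any = 1 + H"
  by (rule fps_cancel[of "1"])
    (use V12_TFT[of has_trivial any, simplified gf_simps] base_eqs in algebra, simp)

lemma V12_TFT_has_empty [class_gf]: "V12 True False True has_trivial empty = C - X * H"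
  by (rule fps_cancel[of "1"])
    (use V12_TFT[of has_trivial empty, simplified gf_simps] base_eqs in algebra, simp)

lemma V12_TFT_nechain_any [class_gf]: "V12 True False True nechain any = C - X * X * C * D"
  by (rule fps_cancel[of "1"])
    (use V12_TFT[of nechain any, simplified gf_simps] base_eqs in algebra, simp)

lemma V12_TFT_nechain_chain [class_gf]: "V12 True False True nechain chain = C - X * X * D * D"
  by (rule fps_cancel[of "1"])
    (use V12_TFT[of nechain chain, simplified gf_simps] base_eqs in algebra, simp)

lemma V12_TFT_nechain_empty [class_gf]: "V12 True False True nechain empty = C - X * X * D"
  by (rule fps_cancel[of "1"])
    (use V12_TFT[of nechain empty, simplified gf_simps] base_eqs in algebra, simp)

lemma V12_TFT_single_any [class_gf]: "V12 True False True single any = C - X * X * C"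
  by (rule fps_cancel[of "1"])
    (use V12_TFT[of single any, simplified gf_simps] base_eqs in algebra, simp)

lemma V12_TFT_single_chain [class_gf]: "V12 True False True single chain = C - X * X * D"
  by (rule fps_cancel[of "1"])
    (use V12_TFT[of single chain, simplified gf_simps] base_eqs in algebra, simp)

lemma V12_TFT_single_empty [class_gf]: "V12 True False True single empty = C - X * X"
  by (rule fps_cancel[of "1"])
    (use V12_TFT[of single empty, simplified gf_simps] base_eqs in algebra, simp)

lemma V12_FFT_nonempty_any [class_gf]: "V12 False False True nonempty any = D"
  by (rule fps_cancel[of "1 - X"])
    (use V12_FFT[of nonempty any, simplified gf_simps] base_eqs in algebra, simp)

lemma V12_FFT_nonempty_chain [class_gf]: "V12 False False True nonempty chain = D"
  by (rule fps_cancel[of "1 - X * C"])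
    (use V12_FFT[of nonempty chain, simplified gf_simps] base_eqs in algebra, simp)

lemma V12_FFT_nonempty_empty [class_gf]: "V12 False False True nonempty empty = 1 + X * C"
  by (rule fps_cancel[of "1 - X * C"])
    (use V12_FFT[of nonempty empty, simplified gf_simps] base_eqs in algebra, simp)

lemma V12_FFT_has_any [class_gf]: "V12 False False True has_trivial any = 1 + X * C"
  by (rule fps_cancel[of "1 - X * C + X * H"])
    (use V12_FFT[of has_trivial any, simplified gf_simps] base_eqs in algebra, simp)

lemma V12_FFT_has_empty [class_gf]: "V12 False False True has_trivial empty = 1 + H"
  by (rule fps_cancel[of "1 - X * C"])
    (use V12_FFT[of has_trivial empty, simplified gf_simps] base_eqs in algebra, simp)

lemma V12_FFT_first_any [class_gf]: "V12 False False True first_trivial any = K"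
  by (rule fps_cancel[of "1 - X * C + X * X * C"])
    (use V12_FFT[of first_trivial any, simplified gf_simps] base_eqs K_eq in algebra, simp)

lemma V12_FFT_first_chain [class_gf]:
  "V12 False False True first_trivial chain = C - X * (C - 1) * D"
  by (rule fps_cancel[of "1 - X * C"])
    (use V12_FFT[of first_trivial chain, simplified gf_simps] base_eqs in algebra, simp)

lemma V12_FFT_first_empty [class_gf]: "V12 False False True first_trivial empty = C - X * (C - 1)"
  by (rule fps_cancel[of "1 - X * C"])
    (use V12_FFT[of first_trivial empty, simplified gf_simps] base_eqs in algebra, simp)

lemma V12_FTT_nonempty_any [class_gf]: "V12 False True True nonempty any = D"
  by (rule fps_cancel[of "1 - X"])
    (use V12_FTT[of nonempty any, simplified gf_simps] base_eqs in algebra, simp)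

lemma V12_FTT_nonempty_empty [class_gf]: "V12 False True True nonempty empty = C - X * (C - 1) * D"
  by (rule fps_cancel[of "1 - X"])
    (use V12_FTT[of nonempty empty, simplified gf_simps] base_eqs in algebra, simp)

lemma V12_FTT_indec_any [class_gf]: "V12 False True True indec any = C - X * (C - 1) * D"
  by (rule fps_cancel[of "1 - X"])
    (use V12_FTT[of indec any, simplified gf_simps] base_eqs in algebra, simp)

lemma V12_FTT_last_any [class_gf]: "V12 False True True last_trivial any = C - X * (C - 1) * D"
  by (rule fps_cancel[of "1 - X"])
    (use V12_FTT[of last_trivial any, simplified gf_simps] base_eqs in algebra, simp)

text \<open>\<open>V12_FTT\<close> depends on \<open>Y\<close> and \<open>E\<close> only through
  \<open>gf E * gf Y\<close>, which is \<open>X * C * D\<close> on both sides.\<close>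

lemma V12_FTT_indec_chain [class_gf]:
  "V12 False True True indec chain = V12 False True True nechain any"
  by (rule fps_cancel[of "1 - X"])
    (use V12_FTT[of indec chain, simplified gf_simps]
      V12_FTT[of nechain any, simplified gf_simps] base_eqs in algebra, simp)

lemma V12_FTT_indec_empty [class_gf]: "V12 False True True indec empty = C - X * X * C * D"
  by (rule fps_cancel[of "1 - X"])
    (use V12_FTT[of indec empty, simplified gf_simps] base_eqs in algebra, simp)

lemma V12_FTT_last_empty [class_gf]: "V12 False True True last_trivial empty = C - X * X * C * D"
  by (rule fps_cancel[of "1 - X"])
    (use V12_FTT[of last_trivial empty, simplified gf_simps] base_eqs in algebra, simp)

lemma V12_FTT_single_any [class_gf]: "V12 False True True single any = C - X * X * C * D"
  by (rule fps_cancel[of "1 - X"])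
    (use V12_FTT[of single any, simplified gf_simps] base_eqs in algebra, simp)

lemma V12_FTT_nechain_empty [class_gf]: "V12 False True True nechain empty = C - X * X * D * D"
  by (rule fps_cancel[of "1 - X"])
    (use V12_FTT[of nechain empty, simplified gf_simps] base_eqs in algebra, simp)

lemma V12_FTT_single_chain [class_gf]: "V12 False True True single chain = C - X * X * D * D"
  by (rule fps_cancel[of "1 - X"])
    (use V12_FTT[of single chain, simplified gf_simps] base_eqs in algebra, simp)

lemma V12_FTT_single_empty [class_gf]: "V12 False True True single empty = C - X * X * D"
  by (rule fps_cancel[of "1 - X"])
    (use V12_FTT[of single empty, simplified gf_simps] base_eqs in algebra, simp)

lemma V12_TFF_nonempty_any [class_gf]: "V12 True False False nonempty any = 1 + X * C"
  by (rule fps_cancel[of "1"])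
    (use V12_TFF[of nonempty any, simplified gf_simps] base_eqs in algebra, simp)

lemma V12_TFF_nonempty_empty [class_gf]: "V12 True False False nonempty empty = 1 + H"
  by (rule fps_cancel[of "1 - X * C + X"])
    (use V12_TFF[of nonempty empty, simplified gf_simps] base_eqs in algebra, simp)

lemma V12_TFF_indec_any [class_gf]: "V12 True False False indec any = 1 + X * C"
  by (rule fps_cancel[of "1 - X * C"])
    (use V12_TFF[of indec any, simplified gf_simps] base_eqs in algebra, simp)

lemma V12_TFF_indec_empty [class_gf]: "V12 True False False indec empty = C - X * (C - 1)"
  by (rule fps_cancel[of "1 - X * C"])
    (use V12_TFF[of indec empty, simplified gf_simps] base_eqs in algebra, simp)

lemma V12_TFF_nechain_any [class_gf]: "V12 True False False nechain any = C - X * (C - 1) * D"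
  by (rule fps_cancel[of "1 - X * C"])
    (use V12_TFF[of nechain any, simplified gf_simps] base_eqs in algebra, simp)

lemma V12_TFF_nechain_empty [class_gf]: "V12 True False False nechain empty = C - X * X * C * D"
  by (rule fps_cancel[of "1 - X * C"])
    (use V12_TFF[of nechain empty, simplified gf_simps] base_eqs in algebra, simp)

lemma V12_TFF_last_any [class_gf]: "V12 True False False last_trivial any = C - X * (C - 1)"
  by (rule fps_cancel[of "1 - X * C"])
    (use V12_TFF[of last_trivial any, simplified gf_simps] base_eqs in algebra, simp)

lemma V12_TFF_last_empty [class_gf]: "V12 True False False last_trivial empty = C - X * H"
  \<comment> \<open>The product of the coefficient of the unknown series and the coefficient of the
    joint series in \<open>joint12_last_empty\<close>.\<close>
  by (rule fps_cancel[of "(1 - X * C) * (1 - X * C + X)"])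
    (use V12_TFF[of last_trivial empty, simplified gf_simps]
      joint12_last_empty[of True False, simplified] base_eqs in algebra, simp)

lemma V12_TFF_single_any [class_gf]: "V12 True False False single any = C - X * (C - 1)"
  by (rule fps_cancel[of "1 - X * C"])
    (use V12_TFF[of single any, simplified gf_simps] base_eqs in algebra, simp)

lemma V12_TFF_single_empty [class_gf]: "V12 True False False single empty = C - X * X * C"
  by (rule fps_cancel[of "1 - X * C"])
    (use V12_TFF[of single empty, simplified gf_simps] base_eqs in algebra, simp)

lemma V12_TFF_first_any [class_gf]: "V12 True False False first_trivial any = 1 + H"
  by (rule fps_cancel[of "1 + X - X * C"])
    (use V12_TFF[of first_trivial any, simplified gf_simps]
      joint12_first[of True] base_eqs in algebra, simp)

lemma V12_TFF_has_any [class_gf]: "V12 True False False has_trivial any = 1 + H"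
  by (rule fps_cancel[of "1 + X - X * C"])
    (use V12_TFF[of has_trivial any, simplified gf_simps]
      joint12_has[of True] base_eqs in algebra, simp)

lemma V12_FFF_nonempty_any [class_gf]: "V12 False False False nonempty any = D"
  by (rule fps_cancel[of "1 - X"])
    (use V12_FFF[of nonempty any, simplified gf_simps] base_eqs in algebra, simp)

lemma V12_FFF_first_any [class_gf]: "V12 False False False first_trivial any = M"
  \<comment> \<open>Eliminating the joint series leaves \<open>V = 1 + X (V^2 - V + 1)\<close>,
    which is \<open>M_eq\<close>. Subtracting the equations of \<open>V\<close> and \<open>M\<close>
    gives this factor times \<open>V - M\<close>.\<close>
  by (rule fps_cancel[of "1 + X - X * ((V12 False False False first_trivial any) + M)"])
    (use V12_FFF[of first_trivial any, simplified gf_simps]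
      joint12_first[of False] M_eq base_eqs in algebra, simp)

lemma V12_FFF_has_any [class_gf]: "V12 False False False has_trivial any = M"
  by (rule fps_cancel[of "1 + X - X * ((V12 False False False has_trivial any) + M)"])
    (use V12_FFF[of has_trivial any, simplified gf_simps]
      joint12_has[of False] M_eq base_eqs in algebra, simp)

lemma V12_FTF_nonempty_any [class_gf]: "V12 False True False nonempty any = D"
  by (rule fps_cancel[of "1 - X"])
    (use V12_FTF[of nonempty any, simplified gf_simps] base_eqs in algebra, simp)

lemma V12_FTF_indec_any [class_gf]: "V12 False True False indec any = D"
  by (rule fps_cancel[of "1 - X - X * C + X * X * C"])
    (use V12_FTF[of indec any, simplified gf_simps] base_eqs in algebra, simp)

lemma V12_FTF_nechain_any [class_gf]: "V12 False True False nechain any = D"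
  by (rule fps_cancel[of "1 - X - X * C"])
    (use V12_FTF[of nechain any, simplified gf_simps] base_eqs in algebra, simp)

lemma V12_FTF_last_any [class_gf]: "V12 False True False last_trivial any = 1 + X * C"
  by (rule fps_cancel[of "1 - X - X * C"])
    (use V12_FTF[of last_trivial any, simplified gf_simps] base_eqs in algebra, simp)

lemma V12_FTF_single_any [class_gf]: "V12 False True False single any = 1 + X * C"
  by (rule fps_cancel[of "1 - X - X * C"])
    (use V12_FTF[of single any, simplified gf_simps] base_eqs in algebra, simp)

lemma V12_FTF_nonempty_empty [class_gf]: "V12 False True False nonempty empty = 1 + X * C"
  by (rule fps_cancel[of "1 - X * C"])
    (use V12_FTF[of nonempty empty, simplified gf_simps] base_eqs in algebra, simp)

lemma V12_FTF_indec_empty [class_gf]: "V12 False True False indec empty = K"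
  \<comment> \<open>The first factor is the coefficient of the unknown series, the second that of
    \<open>K\<close> in \<open>K_eq\<close>.\<close>
  by (rule fps_cancel[of "(1 - X - X * C + X * X) * (1 - X * C + X * X * C)"])
    (use V12_FTF[of indec empty, simplified gf_simps] base_eqs K_eq in algebra, simp)

lemma V12_FTF_nechain_empty [class_gf]: "V12 False True False nechain empty = C - X * (C - 1) * D"
  by (rule fps_cancel[of "1 - X - X * C"])
    (use V12_FTF[of nechain empty, simplified gf_simps] base_eqs in algebra, simp)

lemma V12_FTF_last_empty [class_gf]: "V12 False True False last_trivial empty = 1 + H"
  by (rule fps_cancel[of "(1 - X - X * C) * (1 - X * C + X)"])
    (use V12_FTF[of last_trivial empty, simplified gf_simps]
      joint12_last_empty[of False True, simplified] base_eqs in algebra, simp)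

lemma V12_FTF_single_empty [class_gf]: "V12 False True False single empty = C - X * (C - 1)"
  by (rule fps_cancel[of "1 - X - X * C"])
    (use V12_FTF[of single empty, simplified gf_simps] base_eqs in algebra, simp)

lemma V21_TFT_nonempty [class_gf]: "V21 True False True nonempty = 1 + X * C"
  by (rule fps_cancel[of "1"])
    (use V21_TFT[of nonempty, simplified gf_simps] base_eqs in algebra, simp)

lemma V21_TFT_first [class_gf]: "V21 True False True first_trivial = C - X * (C - 1)"
  by (rule fps_cancel[of "1"])
    (use V21_TFT[of first_trivial, simplified gf_simps] base_eqs in algebra, simp)

lemma V21_TFT_last [class_gf]: "V21 True False True last_trivial = C - X * (C - 1)"
  by (rule fps_cancel[of "1"])
    (use V21_TFT[of last_trivial, simplified gf_simps] base_eqs in algebra, simp)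

lemma V21_TFT_indec [class_gf]: "V21 True False True indec = C - X * (C - 1)"
  by (rule fps_cancel[of "1"])
    (use V21_TFT[of indec, simplified gf_simps] base_eqs in algebra, simp)

lemma V21_TFT_has [class_gf]: "V21 True False True has_trivial = 1 + H"
  by (rule fps_cancel[of "1"])
    (use V21_TFT[of has_trivial, simplified gf_simps] base_eqs in algebra, simp)

lemma V21_TFT_nechain [class_gf]: "V21 True False True nechain = C - X * X * C * D"
  by (rule fps_cancel[of "1"])
    (use V21_TFT[of nechain, simplified gf_simps] base_eqs in algebra, simp)

lemma V21_TFT_single [class_gf]: "V21 True False True single = C - X * X * C"
  by (rule fps_cancel[of "1"])
    (use V21_TFT[of single, simplified gf_simps] base_eqs in algebra, simp)

lemma V21_TFF_nonempty [class_gf]: "V21 True False False nonempty = D"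
  by (rule fps_cancel[of "1 - X"])
    (use V21_TFF[of nonempty, simplified gf_simps] base_eqs in algebra, simp)

lemma V21_TFF_has [class_gf]: "V21 True False False has_trivial = 1 + X * C"
  by (rule fps_cancel[of "1 - X * C + X * H"])
    (use V21_TFF[of has_trivial, simplified gf_simps] base_eqs in algebra, simp)

lemma V21_TFF_first [class_gf]: "V21 True False False first_trivial = K"
  by (rule fps_cancel[of "1 - X * C + X * X * C"])
    (use V21_TFF[of first_trivial, simplified gf_simps] base_eqs K_eq in algebra, simp)

lemma V21_TFF_last [class_gf]: "V21 True False False last_trivial = K"
  by (rule fps_cancel[of "1 - X * C + X * X * C"])
    (use V21_TFF[of last_trivial, simplified gf_simps] base_eqs K_eq in algebra, simp)

lemma V21_FFT_nonempty [class_gf]: "V21 False False True nonempty = 1 + X * C"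
  by (rule fps_cancel[of "1"])
    (use V21_FFT[of nonempty, simplified gf_simps] base_eqs in algebra, simp)

lemma V21_FFT_first [class_gf]: "V21 False False True first_trivial = 1 + X * C"
  by (rule fps_cancel[of "1 - X * C"])
    (use V21_FFT[of first_trivial, simplified gf_simps] base_eqs in algebra, simp)

lemma V21_FFT_has [class_gf]: "V21 False False True has_trivial = 1 + X * C"
  by (rule fps_cancel[of "1 - X * C + X * H"])
    (use V21_FFT[of has_trivial, simplified gf_simps]
      joint21_has_FFT base_eqs in algebra, simp)

lemma V21_FFT_last [class_gf]: "V21 False False True last_trivial = K"
  by (rule fps_cancel[of "1 - X * C + X * X * C"])
    (use V21_FFT[of last_trivial, simplified gf_simps]
      joint21_last_FFT base_eqs K_eq in algebra, simp)

lemma V21_FFT_indec [class_gf]: "V21 False False True indec = 1 + H"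
  by (rule fps_cancel[of "1 - X * C + X"])
    (use V21_FFT[of indec, simplified gf_simps]
      joint21_indec[of False True] base_eqs in algebra, simp)

lemma V21_FFT_nechain [class_gf]: "V21 False False True nechain = C - X * (C - 1)"
  by (rule fps_cancel[of "1 - X * C"])
    (use V21_FFT[of nechain, simplified gf_simps] base_eqs in algebra, simp)

lemma V21_FFT_single [class_gf]: "V21 False False True single = C - X * (C - 1)"
  by (rule fps_cancel[of "1 - X * C"])
    (use V21_FFT[of single, simplified gf_simps] base_eqs in algebra, simp)

lemma V21_FFF_nonempty [class_gf]: "V21 False False False nonempty = D"
  by (rule fps_cancel[of "1 - X"])
    (use V21_FFF[of nonempty, simplified gf_simps] base_eqs in algebra, simp)

lemma V21_FFF_first [class_gf]: "V21 False False False first_trivial = D"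
  \<comment> \<open>The unknown satisfies \<open>V = 1 + X (1 - X) V^2\<close>, and so does
    \<open>D\<close> because \<open>(1 - X) D = 1\<close>; the factor comes from the
    difference.\<close>
  by (rule fps_cancel[of "1 - X * (1 - X) * ((V21 False False False first_trivial) + D)"])
    (use V21_FFF[of first_trivial, simplified gf_simps] base_eqs in algebra, simp)

lemma V21_FFF_has [class_gf]: "V21 False False False has_trivial = D"
  \<comment> \<open>Let \<open>U\<close> be the joint series and \<open>W = V - U\<close>. Then
    \<open>V (1 - X W) = 1\<close>, and the equation of \<open>U\<close> becomes
    \<open>(W - 1) (1 - X W) = 0\<close>. Multiplying by \<open>V\<close> yields
    \<open>W = 1\<close>, which is what \<open>V = D\<close> requires.\<close>
  by (rule fps_cancel[of "1 - X * ((V21 False False False has_trivial) - gf (\<lambda>t. has_trivial t \<and> \<not> contains21 False False False has_trivial t))"])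
    (use V21_FFF[of has_trivial, simplified gf_simps]
      joint21_has_FFF base_eqs in algebra, simp)

lemma V21_FFF_last [class_gf]: "V21 False False False last_trivial = D"
  \<comment> \<open>With \<open>W = V - U\<close>, both \<open>V (1 - X W) = 1\<close> and
    \<open>U (1 - X W) = X\<close> hold, so \<open>U = X V\<close> and
    \<open>V = 1 + X (1 - X) V^2\<close>. The factor is that of the difference \<open>V - D\<close>,
    with \<open>W\<close> in place of \<open>(1 - X) V\<close>.\<close>
  by (rule fps_cancel[of "1 - X * ((V21 False False False last_trivial) - gf (\<lambda>t. last_trivial t \<and> \<not> contains21 False False False last_trivial t) + 1)"])
    (use V21_FFF[of last_trivial, simplified gf_simps]
      joint21_last_FFF base_eqs in algebra, simp)

lemma V21_FFF_indec [class_gf]: "V21 False False False indec = M"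
  by (rule fps_cancel[of "1 + X - X * ((V21 False False False indec) + M)"])
    (use V21_FFF[of indec, simplified gf_simps]
      joint21_indec[of False False] M_eq base_eqs in algebra, simp)

lemma V21_FFF_nechain [class_gf]: "V21 False False False nechain = V21 False False False single"
  by (rule fps_cancel[of "1 + X * X - X * ((V21 False False False nechain) + V21 False False False single)"])
    (use V21_FFF[of nechain, simplified gf_simps]
      V21_FFF[of single, simplified gf_simps] base_eqs in algebra, simp)

lemma V21_TTT_nonempty [class_gf]: "V21 True True True nonempty = C - X * (C - 1)"
  by (rule fps_cancel[of "1"])
    (use V21_TTT[of nonempty, simplified gf_simps] base_eqs in algebra, simp)

lemma V21_TTT_has [class_gf]: "V21 True True True has_trivial = C - X * H"
  by (rule fps_cancel[of "1"])
    (use V21_TTT[of has_trivial, simplified gf_simps] base_eqs in algebra, simp)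

lemma V21_TTT_first [class_gf]: "V21 True True True first_trivial = C - X * X * C"
  by (rule fps_cancel[of "1"])
    (use V21_TTT[of first_trivial, simplified gf_simps] base_eqs in algebra, simp)

lemma V21_TTT_last [class_gf]: "V21 True True True last_trivial = C - X * X * C"
  by (rule fps_cancel[of "1"])
    (use V21_TTT[of last_trivial, simplified gf_simps] base_eqs in algebra, simp)

lemma V21_TTT_indec [class_gf]: "V21 True True True indec = C - X * X * C"
  by (rule fps_cancel[of "1"])
    (use V21_TTT[of indec, simplified gf_simps] base_eqs in algebra, simp)

lemma V21_TTT_nechain [class_gf]: "V21 True True True nechain = C - X * X * D"
  by (rule fps_cancel[of "1"])
    (use V21_TTT[of nechain, simplified gf_simps] base_eqs in algebra, simp)

lemma V21_TTT_single [class_gf]: "V21 True True True single = C - X * X"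
  by (rule fps_cancel[of "1"])
    (use V21_TTT[of single, simplified gf_simps] base_eqs in algebra, simp)

lemma V21_TTF_nonempty [class_gf]: "V21 True True False nonempty = 1 + X * C"
  by (rule fps_cancel[of "1 - X * C"])
    (use V21_TTF[of nonempty, simplified gf_simps] base_eqs in algebra, simp)

lemma V21_TTF_has [class_gf]: "V21 True True False has_trivial = 1 + H"
  by (rule fps_cancel[of "1 - X * C"])
    (use V21_TTF[of has_trivial, simplified gf_simps] base_eqs in algebra, simp)

lemma V21_TTF_first [class_gf]: "V21 True True False first_trivial = C - X * (C - 1)"
  by (rule fps_cancel[of "1 - X * C"])
    (use V21_TTF[of first_trivial, simplified gf_simps] base_eqs in algebra, simp)

lemma V21_TTF_last [class_gf]: "V21 True True False last_trivial = C - X * (C - 1)"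
  by (rule fps_cancel[of "1 - X * C"])
    (use V21_TTF[of last_trivial, simplified gf_simps] base_eqs in algebra, simp)

lemma V21_TTF_indec [class_gf]: "V21 True True False indec = C - X * (C - 1)"
  by (rule fps_cancel[of "1 - X * C"])
    (use V21_TTF[of indec, simplified gf_simps] base_eqs in algebra, simp)

lemma V21_TTF_nechain [class_gf]: "V21 True True False nechain = C - X * X * C * D"
  by (rule fps_cancel[of "1 - X * C"])
    (use V21_TTF[of nechain, simplified gf_simps] base_eqs in algebra, simp)

lemma V21_TTF_single [class_gf]: "V21 True True False single = C - X * X * C"
  by (rule fps_cancel[of "1 - X * C"])
    (use V21_TTF[of single, simplified gf_simps] base_eqs in algebra, simp)

lemma V21_FTT_nonempty [class_gf]: "V21 False True True nonempty = C - X * (C - 1)"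
  by (rule fps_cancel[of "1"])
    (use V21_FTT[of nonempty, simplified gf_simps] base_eqs in algebra, simp)

lemma V21_FTT_first [class_gf]: "V21 False True True first_trivial = C - X * X * C * D"
  by (rule fps_cancel[of "1 - X"])
    (use V21_FTT[of first_trivial, simplified gf_simps] base_eqs in algebra, simp)

lemma V21_FTT_last [class_gf]: "V21 False True True last_trivial = C - X * X * C * D"
  by (rule fps_cancel[of "1 - X"])
    (use V21_FTT[of last_trivial, simplified gf_simps] base_eqs in algebra, simp)

lemma V21_FTT_indec [class_gf]: "V21 False True True indec = C - X * X * C"
  by (rule fps_cancel[of "1"])
    (use V21_FTT[of indec, simplified gf_simps]
      joint21_indec[of True True] base_eqs in algebra, simp)

lemma V21_FTT_nechain [class_gf]: "V21 False True True nechain = C - X * X * D"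
  by (rule fps_cancel[of "1 - X"])
    (use V21_FTT[of nechain, simplified gf_simps] base_eqs in algebra, simp)

lemma V21_FTT_single [class_gf]: "V21 False True True single = C - X * X * D"
  by (rule fps_cancel[of "1 - X"])
    (use V21_FTT[of single, simplified gf_simps] base_eqs in algebra, simp)

lemma V21_FTF_nonempty [class_gf]: "V21 False True False nonempty = 1 + X * C"
  by (rule fps_cancel[of "1 - X * C"])
    (use V21_FTF[of nonempty, simplified gf_simps] base_eqs in algebra, simp)

lemma V21_FTF_has [class_gf]: "V21 False True False has_trivial = 1 + X * C"
  \<comment> \<open>The determinant of the linear system for the unknown \<open>V\<close> and the
    joint series \<open>U\<close>, the second equation being
    \<open>(1 - X C + X) U = X V\<close>.\<close>
  by (rule fps_cancel[of "(1 - X * C + X) * (1 - X - X * C) + X * X"])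
    (use V21_FTF[of has_trivial, simplified gf_simps]
      joint21_has_FTF base_eqs in algebra, simp)

lemma V21_FTF_first [class_gf]: "V21 False True False first_trivial = K"
  by (rule fps_cancel[of "(1 - X - X * C + X * X) * (1 - X * C + X * X * C)"])
    (use V21_FTF[of first_trivial, simplified gf_simps] base_eqs K_eq in algebra, simp)

lemma V21_FTF_last [class_gf]: "V21 False True False last_trivial = 1 + X * C"
  by (rule fps_cancel[of "1 - X - X * C"])
    (use V21_FTF[of last_trivial, simplified gf_simps]
      joint21_last_FTF base_eqs in algebra, simp)

lemma V21_FTF_indec [class_gf]: "V21 False True False indec = 1 + H"
  by (rule fps_cancel[of "(1 + X) * (1 - X * C) - X"])
    (use V21_FTF[of indec, simplified gf_simps]
      joint21_indec[of True False] base_eqs in algebra, simp)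

lemma V21_FTF_nechain [class_gf]: "V21 False True False nechain = C - X * (C - 1)"
  by (rule fps_cancel[of "1 - X - X * C"])
    (use V21_FTF[of nechain, simplified gf_simps] base_eqs in algebra, simp)

lemma V21_FTF_single [class_gf]: "V21 False True False single = C - X * (C - 1)"
  by (rule fps_cancel[of "1 - X - X * C"])
    (use V21_FTF[of single, simplified gf_simps] base_eqs in algebra, simp)

section \<open>Mesh patterns in decomposed point sets\<close>

text \<open>Column or row of a cell cut out by one or two grid lines. A coordinate on a line counts
  to its upper side; in a permutation the points outside an occurrence never lie on its
  lines.\<close>

definition pos1 :: "nat \<Rightarrow> nat \<Rightarrow> nat" where
  "pos1 u v = (if v < u then 0 else 1)"

definition pos2 :: "nat \<Rightarrow> nat \<Rightarrow> nat \<Rightarrow> nat" where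
  "pos2 u w v = (if v < u then 0 else if v < w then 1 else 2)"

text \<open>Phrased for arbitrary point sets, through the cell of each remaining point, so that the
  pieces of a plot can be treated without standardising them.\<close>

definition occurs1 :: "(nat \<times> nat) set \<Rightarrow> (nat \<times> nat) set \<Rightarrow> bool" where
  "occurs1 Q P \<longleftrightarrow> (\<exists>x\<in>P. \<forall>z\<in>P. z \<noteq> x \<longrightarrow> (pos1 (fst x) (fst z), pos1 (snd x) (snd z)) \<notin> Q)"

definition occurs12 :: "(nat \<times> nat) set \<Rightarrow> (nat \<times> nat) set \<Rightarrow> bool" where
  "occurs12 R P \<longleftrightarrow> (\<exists>x\<in>P. \<exists>y\<in>P. fst x < fst y \<and> snd x < snd y \<and>
     (\<forall>z\<in>P. z \<noteq> x \<longrightarrow> z \<noteq> y \<longrightarrow> (pos2 (fst x) (fst y) (fst z), pos2 (snd x) (snd y) (snd z)) \<notin> R))"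

definition occurs21 :: "(nat \<times> nat) set \<Rightarrow> (nat \<times> nat) set \<Rightarrow> bool" where
  "occurs21 R P \<longleftrightarrow> (\<exists>x\<in>P. \<exists>y\<in>P. fst x < fst y \<and> snd y < snd x \<and>
     (\<forall>z\<in>P. z \<noteq> x \<longrightarrow> z \<noteq> y \<longrightarrow> (pos2 (fst x) (fst y) (fst z), pos2 (snd y) (snd x) (snd z)) \<notin> R))"

definition shift :: "nat \<Rightarrow> nat \<Rightarrow> nat \<times> nat \<Rightarrow> nat \<times> nat" where
  "shift a b = (\<lambda>(i, j). (i + a, j + b))"

lemma fst_shift [simp]: "fst (shift a b x) = fst x + a"
  and snd_shift [simp]: "snd (shift a b x) = snd x + b"
  and shift_eq_iff [simp]: "shift a b x = shift a b y \<longleftrightarrow> x = y"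
  by (auto simp: shift_def split: prod.splits)

lemma pos_shift [simp]:
  "pos1 (u + a) (v + a) = pos1 u v" "pos2 (u + a) (w + a) (v + a) = pos2 u w v"
  by (simp_all add: pos1_def pos2_def)

lemma occurs_shift [simp]:
  "occurs1 Q (shift a b ` P) = occurs1 Q P" "occurs12 R (shift a b ` P) = occurs12 R P" "occurs21 R (shift a b ` P) = occurs21 R P"
  by (simp_all add: occurs1_def occurs12_def occurs21_def)

definition decomposes :: "nat \<times> nat \<Rightarrow> (nat \<times> nat) set \<Rightarrow> (nat \<times> nat) set \<Rightarrow> bool" where
  "decomposes z A B \<longleftrightarrow> (\<forall>a\<in>A. fst z < fst a \<and> snd a < snd z) \<and>
     (\<forall>b\<in>B. fst z < fst b \<and> snd z < snd b) \<and> (\<forall>a\<in>A. \<forall>b\<in>B. fst a < fst b \<and> snd a < snd b)"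

lemma decomposes_less:
  assumes "decomposes z A B"
  shows "a \<in> A \<Longrightarrow> fst z < fst a \<and> snd a < snd z"
    and "b \<in> B \<Longrightarrow> fst z < fst b \<and> snd z < snd b"
    and "a \<in> A \<Longrightarrow> b \<in> B \<Longrightarrow> fst a < fst b \<and> snd a < snd b"
  using assms by (auto simp: decomposes_def)

lemma pos_cases:
  "v < u \<Longrightarrow> pos1 u v = 0" "u < v \<Longrightarrow> pos1 u v = 1"
  "v < u \<Longrightarrow> pos2 u w v = 0" "u < v \<Longrightarrow> v < w \<Longrightarrow> pos2 u w v = 1" "u < w \<Longrightarrow> w < v \<Longrightarrow> pos2 u w v = 2"
  "v < w \<Longrightarrow> pos2 u w v = pos1 u v" "u < w \<Longrightarrow> u < v \<Longrightarrow> pos2 u w v = Suc (pos1 w v)"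
  by (auto simp: pos1_def pos2_def)

text \<open>One disjunct for each piece that can hold the point. The root sees \<open>A\<close> at
  the lower right and \<open>B\<close> at the upper right; a point of \<open>A\<close> sees the root
  at the upper left and \<open>B\<close> at the upper right; a point of \<open>B\<close> sees
  everything else outside \<open>B\<close> at the lower left.\<close>

lemma occurs1_decomposes:
  assumes "decomposes z A B"
  shows "occurs1 Q (insert z (A \<union> B)) \<longleftrightarrow>
    ((1, 0) \<notin> Q \<or> A = {}) \<and> ((1, 1) \<notin> Q \<or> B = {}) \<or>
    (0, 1) \<notin> Q \<and> ((1, 1) \<notin> Q \<or> B = {}) \<and> occurs1 Q A \<or>
    (0, 0) \<notin> Q \<and> occurs1 Q B"
proof -
  let ?free = "\<lambda>P x. \<forall>w\<in>P. w \<noteq> x \<longrightarrow> (pos1 (fst x) (fst w), pos1 (snd x) (snd w)) \<notin> Q"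
  note o = decomposes_less[OF assms]
  have d: "a \<in> A \<Longrightarrow> a \<noteq> z" "a \<in> A \<Longrightarrow> z \<noteq> a" "b \<in> B \<Longrightarrow> b \<noteq> z" "b \<in> B \<Longrightarrow> z \<noteq> b"
    "a \<in> A \<Longrightarrow> b \<in> B \<Longrightarrow> a \<noteq> b" "b \<in> B \<Longrightarrow> a \<in> A \<Longrightarrow> b \<noteq> a" for a b
    using o(1,2,3) by blast+
  let ?P = "insert z (A \<union> B)"
  have z: "?free ?P z \<longleftrightarrow> ((1, 0) \<notin> Q \<or> A = {}) \<and> ((1, 1) \<notin> Q \<or> B = {})"
    by (simp add: ball_Un ex_in_conv o d pos_cases cong: ball_cong del: split_paired_All split_paired_Ex; argo?)
  have A: "?free ?P x \<longleftrightarrow> (0, 1) \<notin> Q \<and> ((1, 1) \<notin> Q \<or> B = {}) \<and> ?free A x" if "x \<in> A" for x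
    using that
    by (simp add: ball_Un ex_in_conv o d pos_cases cong: ball_cong del: split_paired_All split_paired_Ex; argo?)
  have B: "?free ?P x \<longleftrightarrow> (0, 0) \<notin> Q \<and> ?free B x" if "x \<in> B" for x
    using that
    by (simp add: ball_Un ex_in_conv o d pos_cases cong: ball_cong del: split_paired_All split_paired_Ex; argo?)
  have "occurs1 Q ?P \<longleftrightarrow> ?free ?P z \<or> (\<exists>x\<in>A. ?free ?P x) \<or> (\<exists>x\<in>B. ?free ?P x)"
    unfolding occurs1_def by (simp only: bex_simps bex_Un)
  also have "(\<exists>x\<in>A. ?free ?P x) \<longleftrightarrow> (0, 1) \<notin> Q \<and> ((1, 1) \<notin> Q \<or> B = {}) \<and> occurs1 Q A"
    unfolding occurs1_def by (simp only: A bex_simps cong: bex_cong)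
  also have "(\<exists>x\<in>B. ?free ?P x) \<longleftrightarrow> (0, 0) \<notin> Q \<and> occurs1 Q B"
    unfolding occurs1_def by (simp only: B bex_simps cong: bex_cong)
  finally show ?thesis unfolding z .
qed

text \<open>The last disjunct merges two cases with the same demand on \<open>B\<close>: if the
  smaller point is the root, \<open>A\<close> fills the cell \<open>(1, 0)\<close>; if it lies in
  \<open>A\<close>, the root is in \<open>(0, 1)\<close> and \<open>A\<close> is cut into the cells
  \<open>(i, j)\<close> with \<open>i, j \<le> 1\<close>.\<close>

lemma occurs12_decomposes:
  assumes "decomposes z A B"
  shows "occurs12 R (insert z (A \<union> B)) \<longleftrightarrow>
    (0, 2) \<notin> R \<and> ((2, 2) \<notin> R \<or> B = {}) \<and> occurs12 R A \<or>
    (0, 0) \<notin> R \<and> occurs12 R B \<or>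
    occurs1 {(i, j). (i + 1, j + 1) \<in> R} B \<and>
      (A = {} \<or> (1, 0) \<notin> R \<or> (0, 1) \<notin> R \<and> occurs1 {(i, j). (i, j) \<in> R \<and> (i, j) \<noteq> (0, 1)} A)"
proof -
  let ?free = "\<lambda>P x y. \<forall>w\<in>P. w \<noteq> x \<longrightarrow> w \<noteq> y \<longrightarrow>
    (pos2 (fst x) (fst y) (fst w), pos2 (snd x) (snd y) (snd w)) \<notin> R"
  let ?free1 = "\<lambda>Q P x. \<forall>w\<in>P. w \<noteq> x \<longrightarrow> (pos1 (fst x) (fst w), pos1 (snd x) (snd w)) \<notin> Q"
  let ?occ = "\<lambda>P x y. fst x < fst y \<and> snd x < snd y \<and> ?free P x y"
  let ?P = "insert z (A \<union> B)"
  let ?QB = "{(i, j). (i + 1, j + 1) \<in> R}" and ?QA = "{(i, j). (i, j) \<in> R \<and> (i, j) \<noteq> (0, 1)}"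
  define occ where "occ x y \<longleftrightarrow> ?occ ?P x y" for x y
  note o = decomposes_less[OF assms]
  have d: "a \<in> A \<Longrightarrow> a \<noteq> z" "a \<in> A \<Longrightarrow> z \<noteq> a" "b \<in> B \<Longrightarrow> b \<noteq> z" "b \<in> B \<Longrightarrow> z \<noteq> b"
    "a \<in> A \<Longrightarrow> b \<in> B \<Longrightarrow> a \<noteq> b" "b \<in> B \<Longrightarrow> a \<in> A \<Longrightarrow> b \<noteq> a" for a b
    using o(1,2,3) by blast+
  have AA: "occ x y \<longleftrightarrow> (0, 2) \<notin> R \<and> ((2, 2) \<notin> R \<or> B = {}) \<and> ?occ A x y"
    if "x \<in> A" "y \<in> A" for x y
  proof (cases "fst x < fst y \<and> snd x < snd y")
    case True
    then show ?thesis using that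
      by (simp add: occ_def ball_Un ex_in_conv o d pos_cases(3,5) cong: ball_cong del: split_paired_All split_paired_Ex; argo?)
  qed (auto simp: occ_def)
  have BB: "occ x y \<longleftrightarrow> (0, 0) \<notin> R \<and> ?occ B x y"
    if "x \<in> B" "y \<in> B" for x y
    using that
    by (simp add: occ_def ball_Un ex_in_conv o d pos_cases(3) cong: ball_cong del: split_paired_All split_paired_Ex; argo?)
  have zB: "occ z y \<longleftrightarrow> (A = {} \<or> (1, 0) \<notin> R) \<and> ?free1 ?QB B y" if "y \<in> B" for y
    using that
    by (simp add: occ_def ball_Un ex_in_conv o d pos_cases(3,4,7) cong: ball_cong del: split_paired_All split_paired_Ex; argo?)
  have AB: "occ x y \<longleftrightarrow> (0, 1) \<notin> R \<and> ?free1 ?QB B y \<and> ?free1 {(i, j). (i, j) \<in> R} A x"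
    if "x \<in> A" "y \<in> B" for x y
    using that
    by (simp add: occ_def ball_Un ex_in_conv o d pos_cases(3,4,6,7) cong: ball_cong del: split_paired_All split_paired_Ex; argo?)
  have no: "\<not> occ z z" "a \<in> A \<Longrightarrow> \<not> occ z a" "a \<in> A \<Longrightarrow> \<not> occ a z" "b \<in> B \<Longrightarrow> \<not> occ b z"
    "b \<in> B \<Longrightarrow> a \<in> A \<Longrightarrow> \<not> occ b a" for a b
    using o(1)[of a] o(2)[of b] o(3)[of a b] by (auto simp: occ_def)
  \<comment> \<open>Dropping the cell \<open>(0, 1)\<close> is harmless under this assumption and
    lets the upper left quadrant become the constant \<open>False\<close> in
    \<open>E_of\<close>.\<close>
  have QA: "occurs1 {(i, j). (i, j) \<in> R} A \<longleftrightarrow> occurs1 ?QA A" if "(0, 1) \<notin> R"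
    using that by (intro arg_cong2[of _ _ _ _ occurs1]) auto
  have "occurs12 R ?P \<longleftrightarrow> (\<exists>x\<in>A. \<exists>y\<in>A. occ x y) \<or> (\<exists>x\<in>B. \<exists>y\<in>B. occ x y) \<or>
      (\<exists>y\<in>B. occ z y) \<or> (\<exists>x\<in>A. \<exists>y\<in>B. occ x y)"
    unfolding occurs12_def occ_def[symmetric] using no by blast
  also have "(\<exists>x\<in>A. \<exists>y\<in>A. occ x y) \<longleftrightarrow> (0, 2) \<notin> R \<and> ((2, 2) \<notin> R \<or> B = {}) \<and> occurs12 R A"
    unfolding occurs12_def by (simp only: AA bex_simps cong: bex_cong)
  also have "(\<exists>x\<in>B. \<exists>y\<in>B. occ x y) \<longleftrightarrow> (0, 0) \<notin> R \<and> occurs12 R B"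
    unfolding occurs12_def by (simp only: BB bex_simps cong: bex_cong)
  also have "(\<exists>y\<in>B. occ z y) \<longleftrightarrow> (A = {} \<or> (1, 0) \<notin> R) \<and> occurs1 ?QB B"
    unfolding occurs1_def by (simp only: zB bex_simps cong: bex_cong)
  also have "(\<exists>x\<in>A. \<exists>y\<in>B. occ x y) \<longleftrightarrow> (0, 1) \<notin> R \<and> occurs1 ?QB B \<and> occurs1 {(i, j). (i, j) \<in> R} A"
    unfolding occurs1_def by (simp only: AB bex_simps cong: bex_cong)
  finally show ?thesis using QA by blast
qed

text \<open>Points of \<open>B\<close> lie above and to the right of all others, so a straddling
  occurrence consists of the root and a point of \<open>A\<close>. The root is its left end, which
  moves the columns of \<open>A\<close> by one, and \<open>B\<close> fills
  \<open>(2, 2)\<close>.\<close>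

lemma occurs21_decomposes:
  assumes "decomposes z A B"
  shows "occurs21 R (insert z (A \<union> B)) \<longleftrightarrow>
    (0, 2) \<notin> R \<and> ((2, 2) \<notin> R \<or> B = {}) \<and> occurs21 R A \<or>
    (0, 0) \<notin> R \<and> occurs21 R B \<or>
    ((2, 2) \<notin> R \<or> B = {}) \<and> occurs1 {(i, j). (i + 1, j) \<in> R} A"
proof -
  let ?free = "\<lambda>P x y. \<forall>w\<in>P. w \<noteq> x \<longrightarrow> w \<noteq> y \<longrightarrow>
    (pos2 (fst x) (fst y) (fst w), pos2 (snd y) (snd x) (snd w)) \<notin> R"
  let ?free1 = "\<lambda>Q P x. \<forall>w\<in>P. w \<noteq> x \<longrightarrow> (pos1 (fst x) (fst w), pos1 (snd x) (snd w)) \<notin> Q"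
  let ?occ = "\<lambda>P x y. fst x < fst y \<and> snd y < snd x \<and> ?free P x y"
  let ?P = "insert z (A \<union> B)"
  let ?Q = "{(i, j). (i + 1, j) \<in> R}"
  define occ where "occ x y \<longleftrightarrow> ?occ ?P x y" for x y
  note o = decomposes_less[OF assms]
  have d: "a \<in> A \<Longrightarrow> a \<noteq> z" "a \<in> A \<Longrightarrow> z \<noteq> a" "b \<in> B \<Longrightarrow> b \<noteq> z" "b \<in> B \<Longrightarrow> z \<noteq> b"
    "a \<in> A \<Longrightarrow> b \<in> B \<Longrightarrow> a \<noteq> b" "b \<in> B \<Longrightarrow> a \<in> A \<Longrightarrow> b \<noteq> a" for a b
    using o(1,2,3) by blast+
  have AA: "occ x y \<longleftrightarrow> (0, 2) \<notin> R \<and> ((2, 2) \<notin> R \<or> B = {}) \<and> ?occ A x y"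
    if "x \<in> A" "y \<in> A" for x y
  proof (cases "fst x < fst y \<and> snd y < snd x")
    case True
    then show ?thesis using that
      by (simp add: occ_def ball_Un ex_in_conv o d pos_cases(3,5) cong: ball_cong del: split_paired_All split_paired_Ex; argo?)
  qed (auto simp: occ_def)
  have BB: "occ x y \<longleftrightarrow> (0, 0) \<notin> R \<and> ?occ B x y"
    if "x \<in> B" "y \<in> B" for x y
    using that
    by (simp add: occ_def ball_Un ex_in_conv o d pos_cases(3) cong: ball_cong del: split_paired_All split_paired_Ex; argo?)
  have zA: "occ z y \<longleftrightarrow> ((2, 2) \<notin> R \<or> B = {}) \<and> ?free1 ?Q A y" if "y \<in> A" for y
    using that
    by (simp add: occ_def ball_Un ex_in_conv o d pos_cases(5,6,7) cong: ball_cong del: split_paired_All split_paired_Ex; argo?)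
  have no: "\<not> occ z z" "b \<in> B \<Longrightarrow> \<not> occ z b" "a \<in> A \<Longrightarrow> \<not> occ a z" "b \<in> B \<Longrightarrow> \<not> occ b z"
    "b \<in> B \<Longrightarrow> a \<in> A \<Longrightarrow> \<not> occ b a" "b \<in> B \<Longrightarrow> a \<in> A \<Longrightarrow> \<not> occ a b" for a b
    using o(1)[of a] o(2)[of b] o(3)[of a b] by (auto simp: occ_def)
  have "occurs21 R ?P \<longleftrightarrow> (\<exists>x\<in>A. \<exists>y\<in>A. occ x y) \<or> (\<exists>x\<in>B. \<exists>y\<in>B. occ x y) \<or>
      (\<exists>y\<in>A. occ z y)"
    unfolding occurs21_def occ_def[symmetric] using no by blast
  also have "(\<exists>x\<in>A. \<exists>y\<in>A. occ x y) \<longleftrightarrow> (0, 2) \<notin> R \<and> ((2, 2) \<notin> R \<or> B = {}) \<and> occurs21 R A"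
    unfolding occurs21_def by (simp only: AA bex_simps cong: bex_cong)
  also have "(\<exists>x\<in>B. \<exists>y\<in>B. occ x y) \<longleftrightarrow> (0, 0) \<notin> R \<and> occurs21 R B"
    unfolding occurs21_def by (simp only: BB bex_simps cong: bex_cong)
  also have "(\<exists>y\<in>A. occ z y) \<longleftrightarrow> ((2, 2) \<notin> R \<or> B = {}) \<and> occurs1 ?Q A"
    unfolding occurs1_def by (simp only: zA bex_simps cong: bex_cong)
  finally show ?thesis .
qed

fun points :: "btree \<Rightarrow> (nat \<times> nat) set" where
  "points Lf = {}"
| "points (Nd l r) = insert (1, size l + 1)
     (shift 1 0 ` points l \<union> shift (size l + 1) (size l + 1) ` points r)"

lemma points_bounds: "x \<in> points t \<Longrightarrow> fst x \<in> {1..size t} \<and> snd x \<in> {1..size t}"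
proof (induction t arbitrary: x)
  case (Nd l r)
  from Nd.prems consider "x = (1, size l + 1)" | y where "y \<in> points l" "x = shift 1 0 y"
    | y where "y \<in> points r" "x = shift (size l + 1) (size l + 1) y"
    by auto
  then show ?case by cases (use Nd.IH in fastforce)+
qed simp

lemma points_eq_empty_iff [simp]: "points t = {} \<longleftrightarrow> t = Lf"
  by (cases t) auto

lemma decomposes_points:
  "decomposes (1, size l + 1) (shift 1 0 ` points l) (shift (size l + 1) (size l + 1) ` points r)"
  unfolding decomposes_def by (auto dest!: points_bounds)

text \<open>The parameters tell which quadrants are shaded: lower left, upper left, lower right,
  upper right.\<close>

fun tree_occurs1 :: "bool \<Rightarrow> bool \<Rightarrow> bool \<Rightarrow> bool \<Rightarrow> btree \<Rightarrow> bool" where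
  "tree_occurs1 ll ul lr ur Lf \<longleftrightarrow> False"
| "tree_occurs1 ll ul lr ur (Nd l r) \<longleftrightarrow> (\<not> lr \<or> l = Lf) \<and> (\<not> ur \<or> r = Lf) \<or>
     \<not> ul \<and> (\<not> ur \<or> r = Lf) \<and> tree_occurs1 ll ul lr ur l \<or> \<not> ll \<and> tree_occurs1 ll ul lr ur r"

lemma occurs1_points: "occurs1 Q (points t) = tree_occurs1 ((0, 0) \<in> Q) ((0, 1) \<in> Q) ((1, 0) \<in> Q) ((1, 1) \<in> Q) t"
proof (induction t)
  case Lf
  show ?case by (simp add: occurs1_def)
next
  case (Nd l r)
  then show ?case
    using occurs1_decomposes[OF decomposes_points, of Q l r] by simp
qed

text \<open>
  For the point of an occurrence that lies in the right (left) subtree, the cells of \<open>R\<close> listed here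
  are its quadrants within that subtree.
\<close>

definition Y_of :: "(nat \<times> nat) set \<Rightarrow> btree \<Rightarrow> bool" where
  "Y_of R = tree_occurs1 ((1, 1) \<in> R) ((1, 2) \<in> R) ((2, 1) \<in> R) ((2, 2) \<in> R)"

definition E_of :: "(nat \<times> nat) set \<Rightarrow> btree \<Rightarrow> bool" where
  "E_of R t \<longleftrightarrow> t = Lf \<or> (1, 0) \<notin> R \<or>
     (0, 1) \<notin> R \<and> tree_occurs1 ((0, 0) \<in> R) False ((1, 0) \<in> R) ((1, 1) \<in> R) t"

definition Z_of :: "(nat \<times> nat) set \<Rightarrow> btree \<Rightarrow> bool" where
  "Z_of R = tree_occurs1 ((1, 0) \<in> R) ((1, 1) \<in> R) ((2, 0) \<in> R) ((2, 1) \<in> R)"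

lemma occurs12_points:
  "occurs12 R (points t) = contains12 ((0, 2) \<in> R) ((2, 2) \<in> R) ((0, 0) \<in> R) (Y_of R) (E_of R) t"
proof (induction t)
  case Lf
  show ?case by (simp add: occurs12_def)
next
  case (Nd l r)
  then show ?case
    using occurs12_decomposes[OF decomposes_points, of R l r]
    by (simp add: occurs1_points Y_of_def E_of_def numeral_2_eq_2; argo?)
qed

lemma occurs21_points:
  "occurs21 R (points t) = contains21 ((0, 2) \<in> R) ((2, 2) \<in> R) ((0, 0) \<in> R) (Z_of R) t"
proof (induction t)
  case Lf
  show ?case by (simp add: occurs21_def)
next
  case (Nd l r)
  then show ?case
    using occurs21_decomposes[OF decomposes_points, of R l r]
    by (simp add: occurs1_points Z_of_def numeral_2_eq_2; argo?)
qed

text \<open>The leftmost, rightmost, highest or lowest point always leaves two adjacent quadrants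
  empty, so shading within such a pair asks only for a point. Otherwise, \<open>indec\<close>: the
  permutation starts with its maximum; \<open>has_trivial\<close>: some point is comparable to all
  others; \<open>nechain\<close>: it ends with 1, hence is decreasing by 231-avoidance;
  \<open>first_trivial\<close>: it starts with 1; \<open>last_trivial\<close>: it ends with its
  maximum.\<close>

lemma tree_occurs1_eqs:
  "tree_occurs1 False False False False = nonempty" "tree_occurs1 True False False False = nonempty"
  "tree_occurs1 False True False False = nonempty" "tree_occurs1 False False True False = nonempty"
  "tree_occurs1 False False False True = nonempty" "tree_occurs1 True True False False = nonempty"
  "tree_occurs1 True False True False = nonempty" "tree_occurs1 False True False True = nonempty"
  "tree_occurs1 False False True True = nonempty" "tree_occurs1 True False False True = indec"
  "tree_occurs1 True True False True = indec" "tree_occurs1 False True True False = has_trivial"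
  "tree_occurs1 True False True True = nechain" "tree_occurs1 True True True False = first_trivial"
  "tree_occurs1 False True True True = last_trivial" "tree_occurs1 True True True True = single"
  by (rule ext; rename_tac t; induct_tac t; auto)+

section \<open>Trees and 231-avoiding permutations\<close>

fun perm_of :: "btree \<Rightarrow> nat \<Rightarrow> nat" where
  "perm_of Lf i = i"
| "perm_of (Nd l r) i = (if i = 0 then 0 else if i = 1 then size l + 1
     else if i \<le> size l + 1 then perm_of l (i - 1)
     else perm_of r (i - (size l + 1)) + (size l + 1))"

lemma perm_of_outside: "i \<notin> {1..size t} \<Longrightarrow> perm_of t i = i"
proof (induction t arbitrary: i)
  case (Nd l r)
  show ?case
  proof (cases "i = 0")
    case False
    then have "i > size l + size r + 1" using Nd.prems by auto
    moreover from this have "perm_of r (i - (size l + 1)) = i - (size l + 1)"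
      by (intro Nd.IH(2)) auto
    ultimately show ?thesis by simp
  qed simp
qed simp

lemma plot_eq_image: "plot n \<pi> = (\<lambda>i. (i, \<pi> i)) ` {1..n}"
  by (auto simp: plot_def)

lemma interval_split: "{1..Suc (a + b)} = insert 1 ((\<lambda>i. i + 1) ` {1..a} \<union> (\<lambda>i. i + (a + 1)) ` {1..b::nat})"
  unfolding image_add_atLeastAtMost' by auto

lemma plot_perm_of: "plot (size t) (perm_of t) = points t"
proof (induction t)
  case Lf
  show ?case by (simp add: plot_def)
next
  case (Nd l r)
  let ?f = "\<lambda>i. (i, perm_of (Nd l r) i)"
  have l: "?f ` (\<lambda>i. i + 1) ` {1..size l} = shift 1 0 ` points l"
    unfolding Nd.IH(1)[symmetric] plot_eq_image image_image
    by (rule image_cong[OF refl]) (auto simp: shift_def)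
  have r: "?f ` (\<lambda>i. i + (size l + 1)) ` {1..size r} = shift (size l + 1) (size l + 1) ` points r"
    unfolding Nd.IH(2)[symmetric] plot_eq_image image_image
    by (rule image_cong[OF refl]) (auto simp: shift_def)
  have "size (Nd l r) = Suc (size l + size r)" by simp
  then show ?case
    unfolding plot_eq_image by (simp only: interval_split image_insert image_Un l r) simp
qed

lemma snd_points: "snd ` points t = {1..size t}"
proof (induction t)
  case (Nd l r)
  have "snd ` points (Nd l r) = insert (size l + 1) (snd ` points l \<union> (\<lambda>i. i + (size l + 1)) ` snd ` points r)"
    by (simp add: image_Un image_image)
  also have "\<dots> = {1..size (Nd l r)}"
    unfolding Nd.IH image_add_atLeastAtMost' by auto
  finally show ?case .
qed simp

lemma perm_of_permutes: "perm_of t permutes {1..size t}"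
proof (rule bij_imp_permutes)
  have "perm_of t ` {1..size t} = {1..size t}"
    using snd_points[of t] by (simp add: plot_perm_of[symmetric] plot_eq_image image_image)
  then show "bij_betw (perm_of t) {1..size t} {1..size t}"
    by (simp add: bij_betw_def eq_card_imp_inj_on)
qed (rule perm_of_outside)

text \<open>The value at 1 reveals the size of the left subtree, and with it the positions that
  encode each subtree.\<close>

lemma perm_of_inj: "size t = size u \<Longrightarrow> perm_of t = perm_of u \<Longrightarrow> t = u"
proof (induction t arbitrary: u)
  case Lf
  then show ?case by (cases u) auto
next
  case (Nd l r)
  from Nd.prems(1) obtain l' r' where u: "u = Nd l' r'" by (cases u) auto
  have s: "size l = size l'" using fun_cong[OF Nd.prems(2), of 1] u by simp
  then have s': "size r = size r'" using Nd.prems(1) u by simp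
  have "perm_of l i = perm_of l' i" for i
  proof (cases "i \<in> {1..size l}")
    case True
    then show ?thesis using fun_cong[OF Nd.prems(2), of "i + 1"] u s by auto
  next
    case False
    then show ?thesis using perm_of_outside s by metis
  qed
  moreover have "perm_of r i = perm_of r' i" for i
  proof (cases "i \<in> {1..size r}")
    case True
    then show ?thesis using fun_cong[OF Nd.prems(2), of "i + (size l + 1)"] u s by auto
  next
    case False
    then show ?thesis using perm_of_outside s' by metis
  qed
  ultimately show ?case using Nd.IH(1)[OF s] Nd.IH(2)[OF s'] u by auto
qed

definition avoids231 :: "nat \<Rightarrow> (nat \<Rightarrow> nat) \<Rightarrow> bool" where
  "avoids231 n \<pi> \<longleftrightarrow>
     (\<forall>i j k. 1 \<le> i \<longrightarrow> i < j \<longrightarrow> j < k \<longrightarrow> k \<le> n \<longrightarrow> \<pi> k < \<pi> i \<longrightarrow> \<not> \<pi> i < \<pi> j)"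

text \<open>Suppose \<open>x\<close>, \<open>y\<close>, \<open>z\<close> form a 231. If
  \<open>x\<close> is the root, the low point \<open>z\<close> and hence \<open>y\<close> lie in
  \<open>l\<close>, below the root. If \<open>x\<close> is in \<open>l\<close>, so are
  \<open>z\<close> and then \<open>y\<close>; if \<open>x\<close> is in \<open>r\<close>, the other
  two come later and are in \<open>r\<close> as well.\<close>

lemma perm_of_avoids231: "avoids231 (size t) (perm_of t)"
proof -
  have *: "\<not> snd x < snd y"
    if "x \<in> points t" "y \<in> points t" "z \<in> points t" "fst x < fst y" "fst y < fst z" "snd z < snd x" for x y z
    using that
  proof (induction t arbitrary: x y z)
    case (Nd l r)
    note o = decomposes_less[OF decomposes_points[of l r]]
    consider "x = (1, size l + 1)" | x' where "x' \<in> points l" "x = shift 1 0 x'"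
      | x' where "x' \<in> points r" "x = shift (size l + 1) (size l + 1) x'"
      using Nd.prems(1) by auto
    then show ?case
    proof cases
      case 1
      have "y \<notin> shift (size l + 1) (size l + 1) ` points r" if "z \<in> shift 1 0 ` points l"
        using o(3)[OF that] Nd.prems(5) by (metis not_less_iff_gr_or_eq)
      then show ?thesis using 1 Nd.prems o(1)[of y] o(2)[of z] by force
    next
      case 2
      have z: "z \<in> shift 1 0 ` points l"
        using o(3)[of x z] 2 Nd.prems by auto
      then have "y \<in> shift 1 0 ` points l"
        using o(3)[of z y] 2 Nd.prems by auto
      then show ?thesis using z 2 Nd.prems(4-) Nd.IH(1) by fastforce
    next
      case 3
      have "y \<in> shift (size l + 1) (size l + 1) ` points r" "z \<in> shift (size l + 1) (size l + 1) ` points r"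
        using o(3)[of y x] o(2)[of x] o(3)[of z x] 3 Nd.prems by auto
      then show ?thesis using 3 Nd.prems(4-) Nd.IH(2) by fastforce
    qed
  qed simp
  have mem: "(i, perm_of t i) \<in> points t" if "1 \<le> i" "i \<le> size t" for i
    using that by (auto simp: plot_perm_of[symmetric] plot_def)
  show ?thesis
    unfolding avoids231_def
  proof (intro allI impI)
    fix i j k assume "1 \<le> i" "i < j" "j < k" "k \<le> size t" "perm_of t k < perm_of t i"
    then show "\<not> perm_of t i < perm_of t j"
      using *[of "(i, perm_of t i)" "(j, perm_of t j)" "(k, perm_of t k)"] mem[of i] mem[of j] mem[of k] by simp
  qed
qed

lemma permutesI_finite:
  assumes "\<And>i. i \<in> {1..n} \<Longrightarrow> f i \<in> {1..n}" "inj_on f {1..n}" "\<And>i. i \<notin> {1..n} \<Longrightarrow> f i = i"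
  shows "f permutes {1..n::nat}"
  using assms by (intro bij_imp_permutes) (auto simp: bij_betw_def endo_inj_surj image_subset_iff)

text \<open>Meant for the positions of the values below the first one, which 231-avoidance makes an
  initial segment after position 1.\<close>

lemma lower_set_eq:
  fixes S :: "nat set"
  assumes "S \<subseteq> {2..n}" "\<And>i j. i \<in> S \<Longrightarrow> j \<in> {2..n} \<Longrightarrow> j < i \<Longrightarrow> j \<in> S"
  shows "S = {2..card S + 1}"
proof (cases "S = {}")
  case False
  have fin: "finite S" using assms(1) finite_subset by blast
  have "S = {2..Max S}"
  proof
    show "S \<subseteq> {2..Max S}" using assms(1) fin by auto
    show "{2..Max S} \<subseteq> S"
    proof
      fix j assume j: "j \<in> {2..Max S}"
      have "Max S \<in> S" using Max_in fin False by blast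
      then show "j \<in> S" using j assms by (cases "j = Max S") force+
    qed
  qed
  moreover have "Max S \<ge> 2" using Max_in[OF fin False] assms(1) by auto
  ultimately have "card S + 1 = Max S" using card_atLeastAtMost[of 2 "Max S"] by simp
  then show ?thesis using \<open>S = {2..Max S}\<close> by simp
qed simp

text \<open>If a value above \<open>\<pi> 1\<close> preceded one below it, the two would complete a
  231 with the first entry. So the values \<open>1..a\<close> occupy the positions
  \<open>2..a + 1\<close>, and the two blocks are standardised to \<open>f\<close> and
  \<open>g\<close>.\<close>

lemma perm_of_surj:
  assumes "\<pi> permutes {1..n}" "avoids231 n \<pi>"
  shows "\<exists>t. size t = n \<and> perm_of t = \<pi>"
  using assms
proof (induction n arbitrary: \<pi> rule: less_induct)
  case (less n)
  show ?case
  proof (cases "n = 0")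
    case True
    then have "\<pi> = id" using less.prems(1) by simp
    then have "size Lf = n \<and> perm_of Lf = \<pi>" using True by (auto simp: id_def)
    then show ?thesis by blast
  next
    case False
    have inj: "inj \<pi>" using less.prems(1) permutes_inj by blast
    have rng: "\<pi> i \<in> {1..n}" if "i \<in> {1..n}" for i
      using less.prems(1) that permutes_in_image by metis
    have fx: "\<pi> i = i" if "i \<notin> {1..n}" for i
      using less.prems(1) that permutes_not_in by metis
    have av: "\<not> \<pi> i < \<pi> j" if "1 \<le> i" "i < j" "j < k" "k \<le> n" "\<pi> k < \<pi> i" for i j k
      using less.prems(2) that unfolding avoids231_def by blast
    define a where "a = \<pi> 1 - 1"
    have p1: "\<pi> 1 = a + 1" "a < n" using rng[of 1] False by (auto simp: a_def)
    define S where "S = {i \<in> {2..n}. \<pi> i \<le> a}"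
    have "S = {2..card S + 1}"
    proof (rule lower_set_eq)
      fix i j assume ij: "i \<in> S" "j \<in> {2..n}" "j < i"
      have "\<pi> j \<noteq> \<pi> 1" using ij(2) injD[OF inj, of j 1] by auto
      moreover have "\<not> \<pi> 1 < \<pi> j" using av[of 1 j i] ij p1(1) by (simp add: S_def)
      ultimately show "j \<in> S" using ij(2) p1(1) by (simp add: S_def)
    qed (auto simp: S_def)
    moreover have "card S = a"
    proof -
      have "\<pi> ` S = {1..a}"
      proof
        show "\<pi> ` S \<subseteq> {1..a}" using rng by (force simp: S_def)
        show "{1..a} \<subseteq> \<pi> ` S"
        proof
          fix v assume v: "v \<in> {1..a}"
          then have "v \<in> \<pi> ` {1..n}" using permutes_image[OF less.prems(1)] p1 by auto
          then obtain i where i: "i \<in> {1..n}" "v = \<pi> i" by blast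
          moreover have "i \<noteq> 1" using i v p1 by auto
          ultimately show "v \<in> \<pi> ` S" using v by (auto simp: S_def)
        qed
      qed
      then show ?thesis using card_image[OF inj_on_subset[OF inj subset_UNIV], of S] by simp
    qed
    ultimately have S: "S = {2..a + 1}" by simp
    have low: "\<pi> i \<in> {1..a}" if "i \<in> {2..a + 1}" for i
    proof -
      have "i \<in> S" unfolding S by (rule that)
      then show ?thesis using rng[of i] by (simp add: S_def)
    qed
    have high: "\<pi> i \<in> {a + 2..n}" if "i \<in> {a + 2..n}" for i
    proof -
      have "i \<notin> S" unfolding S using that by simp
      moreover have "\<pi> i \<noteq> \<pi> 1"
        using that injD[OF inj, of i 1] by fastforce
      ultimately show ?thesis using rng[of i] that p1(1) by (simp add: S_def)
    qed
    define b where "b = n - (a + 1)"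
    have n: "n = a + b + 1" using p1 by (simp add: b_def)
    define f where "f i = (if i \<in> {1..a} then \<pi> (i + 1) else i)" for i
    define g where "g i = (if i \<in> {1..b} then \<pi> (i + (a + 1)) - (a + 1) else i)" for i
    have "f permutes {1..a}"
    proof (rule permutesI_finite)
      show "f i \<in> {1..a}" if "i \<in> {1..a}" for i
        using low[of "i + 1"] that by (simp add: f_def)
      show "inj_on f {1..a}"
        by (rule inj_onI) (use injD[OF inj] in \<open>force simp: f_def\<close>)
    qed (auto simp: f_def)
    moreover have "avoids231 a f"
      unfolding avoids231_def
    proof safe
      fix i j k assume "1 \<le> i" "i < j" "j < k" "k \<le> a" "f k < f i" "f i < f j"
      then show False using av[of "i + 1" "j + 1" "k + 1"] n by (auto simp: f_def)
    qed
    ultimately obtain l where l: "size l = a" "perm_of l = f"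
      using less.IH[of a f] p1 by blast
    have hi: "\<pi> (i + (a + 1)) \<ge> a + 2" "\<pi> (i + (a + 1)) \<le> n" if "i \<in> {1..b}" for i
      using high[of "i + (a + 1)"] that n by auto
    have g_eq: "\<pi> (i + (a + 1)) = g i + (a + 1)" if "i \<in> {1..b}" for i
      using hi[OF that] that by (simp add: g_def)
    have "g permutes {1..b}"
    proof (rule permutesI_finite)
      show "g i \<in> {1..b}" if "i \<in> {1..b}" for i
        using g_eq[OF that] hi[OF that] n by auto
      show "inj_on g {1..b}"
      proof (rule inj_onI)
        fix i j assume "i \<in> {1..b}" "j \<in> {1..b}" "g i = g j"
        then have "\<pi> (i + (a + 1)) = \<pi> (j + (a + 1))" using g_eq by metis
        then show "i = j" using injD[OF inj, of "i + (a + 1)" "j + (a + 1)"] by simp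
      qed
    qed (auto simp: g_def)
    moreover have "avoids231 b g"
      unfolding avoids231_def
    proof safe
      fix i j k assume "1 \<le> i" "i < j" "j < k" "k \<le> b" "g k < g i" "g i < g j"
      then show False using av[of "i + (a + 1)" "j + (a + 1)" "k + (a + 1)"] n g_eq[of i] g_eq[of j] g_eq[of k]
        by auto
    qed
    ultimately obtain r where r: "size r = b" "perm_of r = g"
      using less.IH[of b g] n by auto
    have "perm_of (Nd l r) i = \<pi> i" for i
    proof -
      consider "i = 0" | "i = 1" | "i \<in> {2..a + 1}" | "i \<in> {a + 2..n}" | "i > n"
        by (cases "i = 0"; cases "i = 1"; cases "i \<le> a + 1"; cases "i \<le> n") auto
      then show ?thesis
      proof cases
        case 4
        then have "i - (a + 1) \<in> {1..b}" using n by auto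
        then show ?thesis using g_eq[of "i - (a + 1)"] 4 l r by simp
      next
        case 5
        then show ?thesis using perm_of_outside[of i "Nd l r"] fx l r n by auto
      qed (use l r p1 fx in \<open>auto simp: f_def\<close>)
    qed
    then have "size (Nd l r) = n \<and> perm_of (Nd l r) = \<pi>" using l r n by auto
    then show ?thesis by blast
  qed
qed

section \<open>From mesh occurrences to conditions on the plot\<close>

lemma order_inj_iff:
  "order_inj k n \<alpha> \<longleftrightarrow> (\<forall>i\<in>{1..k}. 1 \<le> \<alpha> i \<and> \<alpha> i \<le> n) \<and>
     (\<forall>i\<in>{1..k}. \<forall>j\<in>{1..k}. i < j \<longrightarrow> \<alpha> i < \<alpha> j)" (is "?L \<longleftrightarrow> ?bd \<and> ?mono")
proof
  assume L: ?L
  have ?mono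
  proof (intro ballI impI)
    fix i j assume ij: "i \<in> {1..k}" "j \<in> {1..k}" "i < j"
    have "mono_on {1..k} \<alpha>" "inj_on \<alpha> {1..k}" using L by (simp_all add: order_inj_def)
    then have "\<alpha> i \<le> \<alpha> j" "\<alpha> i \<noteq> \<alpha> j"
      using ij mono_onD[of "{1..k}" \<alpha> i j] inj_onD[of \<alpha> "{1..k}" i j] by auto
    then show "\<alpha> i < \<alpha> j" by simp
  qed
  moreover have ?bd using L by (force simp: order_inj_def)
  ultimately show "?bd \<and> ?mono" by blast
next
  assume R: "?bd \<and> ?mono"
  have "mono_on {1..k} \<alpha>"
    by (rule mono_onI) (metis R le_less)
  moreover have "inj_on \<alpha> {1..k}"
    by (rule linorder_inj_onI') (use R in force)
  ultimately show ?L using R by (auto simp: order_inj_def)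
qed

lemma order_inj_2: "order_inj 2 n \<alpha> \<longleftrightarrow> 1 \<le> \<alpha> 1 \<and> \<alpha> 1 < \<alpha> 2 \<and> \<alpha> 2 \<le> n"
proof -
  have *: "{1..2} = {1, 2::nat}" by auto
  show ?thesis unfolding order_inj_iff * by auto
qed

lemma order_inj_3: "order_inj 3 n \<alpha> \<longleftrightarrow> 1 \<le> \<alpha> 1 \<and> \<alpha> 1 < \<alpha> 2 \<and> \<alpha> 2 < \<alpha> 3 \<and> \<alpha> 3 \<le> n"
proof -
  have *: "{1..3} = {1, 2, 3::nat}" by auto
  show ?thesis unfolding order_inj_iff * by auto
qed

lemma plot_one_line:
  "plot 2 (one_line [1, 2]) = {(1, 1), (2, 2)}" "plot 2 (one_line [2, 1]) = {(1, 2), (2, 1)}"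
  "plot 3 (one_line [2, 3, 1]) = {(1, 2), (2, 3), (3, 1)}"
proof -
  have "{1..2} = {1, 2::nat}" "{1..3} = {1, 2, 3::nat}" by auto
  then show "plot 2 (one_line [1, 2]) = {(1, 1), (2, 2)}" "plot 2 (one_line [2, 1]) = {(1, 2), (2, 1)}"
    "plot 3 (one_line [2, 3, 1]) = {(1, 2), (2, 3), (3, 1)}"
    unfolding plot_eq_image by (simp_all add: one_line_def)
qed

lemma mem_region_iff:
  assumes "\<alpha> 0 = 0" "\<alpha> 3 = n + 1" "\<beta> 0 = 0" "\<beta> 3 = n + 1" "\<alpha> 1 < \<alpha> 2" "\<beta> 1 < \<beta> 2"
    and "1 \<le> fst z" "fst z \<le> n" "1 \<le> snd z" "snd z \<le> n" "i \<le> 2" "j \<le> 2"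
    and "fst z \<noteq> \<alpha> 1" "fst z \<noteq> \<alpha> 2" "snd z \<noteq> \<beta> 1" "snd z \<noteq> \<beta> 2"
  shows "z \<in> region \<alpha> \<beta> i j \<longleftrightarrow> i = pos2 (\<alpha> 1) (\<alpha> 2) (fst z) \<and> j = pos2 (\<beta> 1) (\<beta> 2) (snd z)"
proof -
  have *: "u \<in> {\<gamma> i + 1..\<gamma> (i + 1) - 1} \<longleftrightarrow> i = pos2 (\<gamma> 1) (\<gamma> 2) u"
    if "\<gamma> 0 = 0" "\<gamma> 3 = n + 1" "\<gamma> 1 < \<gamma> 2" "1 \<le> u" "u \<le> n" "i \<le> 2" "u \<noteq> \<gamma> 1" "u \<noteq> \<gamma> 2"
    for \<gamma> :: "nat \<Rightarrow> nat" and u i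
  proof -
    consider "i = 0" | "i = 1" | "i = 2" using \<open>i \<le> 2\<close> by linarith
    then show ?thesis
      by cases (use that in \<open>auto simp: pos2_def numeral_3_eq_3 numeral_2_eq_2\<close>)
  qed
  show ?thesis
    unfolding region_def mem_Times_iff
    using *[of \<alpha> "fst z" i] *[of \<beta> "snd z" j] assms by simp
qed

text \<open>The two points of the occurrence lie on grid lines and so in no region; every other
  point lies in exactly one. The unordered condition on second coordinates serves \<open>12\<close>
  and \<open>21\<close> alike.\<close>

lemma region_disjoint_iff:
  assumes \<pi>: "\<pi> permutes {1..n}" and R: "R \<subseteq> {0, 1, 2} \<times> {0, 1, 2}"
    and \<alpha>: "\<alpha> 0 = 0" "\<alpha> 3 = n + 1" "\<beta> 0 = 0" "\<beta> 3 = n + 1" "\<alpha> 1 < \<alpha> 2" "\<beta> 1 < \<beta> 2"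
    and xy: "x \<in> plot n \<pi>" "y \<in> plot n \<pi>" "fst x = \<alpha> 1" "fst y = \<alpha> 2" "{snd x, snd y} = {\<beta> 1, \<beta> 2}"
  shows "(\<forall>(i, j)\<in>R. region \<alpha> \<beta> i j \<inter> plot n \<pi> = {}) \<longleftrightarrow>
    (\<forall>z\<in>plot n \<pi>. z \<noteq> x \<longrightarrow> z \<noteq> y \<longrightarrow> (pos2 (\<alpha> 1) (\<alpha> 2) (fst z), pos2 (\<beta> 1) (\<beta> 2) (snd z)) \<notin> R)"
proof -
  have inj: "z = w" if "z \<in> plot n \<pi>" "w \<in> plot n \<pi>" "fst z = fst w \<or> snd z = snd w" for z w
    using that injD[OF permutes_inj[OF \<pi>], of "fst z" "fst w"] by (auto simp: plot_def)
  have bd: "1 \<le> fst z" "fst z \<le> n" "1 \<le> snd z" "snd z \<le> n" if "z \<in> plot n \<pi>" for z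
    using that permutes_in_image[OF \<pi>, of "fst z"] by (auto simp: plot_def)
  have reg: "z \<in> region \<alpha> \<beta> i j \<longleftrightarrow> z \<noteq> x \<and> z \<noteq> y \<and>
      i = pos2 (\<alpha> 1) (\<alpha> 2) (fst z) \<and> j = pos2 (\<beta> 1) (\<beta> 2) (snd z)"
    if z: "z \<in> plot n \<pi>" and ij: "(i, j) \<in> R" for z i j
  proof -
    have le: "i \<le> 2" "j \<le> 2" using subsetD[OF R ij] by auto
    show ?thesis
    proof (cases "z = x \<or> z = y")
      case True
      then have "fst z = \<alpha> 1 \<or> fst z = \<alpha> 2" using xy by auto
      moreover have "i = 0 \<or> i = 1 \<or> i = 2" using le by linarith
      ultimately have "fst z \<notin> {\<alpha> i + 1..\<alpha> (i + 1) - 1}"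
        using \<alpha>(1,2,5) by (elim disjE; simp add: numeral_3_eq_3 numeral_2_eq_2; arith?)
      then have "z \<notin> region \<alpha> \<beta> i j" unfolding region_def mem_Times_iff by blast
      then show ?thesis using True by blast
    next
      case False
      have "fst z \<noteq> \<alpha> 1" "fst z \<noteq> \<alpha> 2"
        using inj[OF z xy(1)] inj[OF z xy(2)] xy(3,4) False by auto
      moreover have "snd z \<noteq> snd x" "snd z \<noteq> snd y"
        using inj[OF z xy(1)] inj[OF z xy(2)] False by auto
      then have "snd z \<noteq> \<beta> 1" "snd z \<noteq> \<beta> 2" using xy(5) by auto
      ultimately show ?thesis
        using mem_region_iff[OF \<alpha> bd[OF z] le] False by blast
    qed
  qed
  show ?thesis (is "?L \<longleftrightarrow> ?R")
  proof
    assume L: ?L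
    show ?R
    proof (intro ballI impI notI)
      fix z assume z: "z \<in> plot n \<pi>" "z \<noteq> x" "z \<noteq> y"
        and m: "(pos2 (\<alpha> 1) (\<alpha> 2) (fst z), pos2 (\<beta> 1) (\<beta> 2) (snd z)) \<in> R"
      then show False using L reg[OF z(1) m] by blast
    qed
  next
    assume ?R
    then show ?L using reg by blast
  qed
qed

lemma mesh_of_simps:
  "plen (mesh_of [a, b] R) = 2" "plen (mesh_of [a, b, c] R) = 3"
  "pperm (mesh_of xs R) = one_line xs" "pmesh (mesh_of xs R) = R"
  by (simp_all add: mesh_of_def)

lemma occurrence_points:
  "{(\<alpha> i, \<beta> j) | i j. (i, j) \<in> S} = (\<lambda>(i, j). (\<alpha> i, \<beta> j)) ` S"
  by auto

lemma avoids_12_iff: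
  assumes "\<pi> permutes {1..n}" "R \<subseteq> {0, 1, 2} \<times> {0, 1, 2}"
  shows "avoids n \<pi> (mesh_of [1, 2] R) \<longleftrightarrow> \<not> occurs12 R (plot n \<pi>)"
proof -
  have "(\<exists>\<omega>. occurrence (mesh_of [1, 2] R) n \<pi> \<omega>) \<longleftrightarrow> occurs12 R (plot n \<pi>)"
  proof
    assume "\<exists>\<omega>. occurrence (mesh_of [1, 2] R) n \<pi> \<omega>"
    then obtain \<alpha> \<beta> where *: "order_inj 2 n \<alpha>" "order_inj 2 n \<beta>"
      "\<alpha> 0 = 0" "\<alpha> 3 = n + 1" "\<beta> 0 = 0" "\<beta> 3 = n + 1"
      "\<forall>(i, j)\<in>R. region \<alpha> \<beta> i j \<inter> plot n \<pi> = {}"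
      "(\<lambda>(i, j). (\<alpha> i, \<beta> j)) ` {(1, 1), (2, 2)} \<subseteq> plot n \<pi>"
      unfolding occurrence_def mesh_of_simps plot_one_line occurrence_points by auto
    then have mem: "(\<alpha> 1, \<beta> 1) \<in> plot n \<pi>" "(\<alpha> 2, \<beta> 2) \<in> plot n \<pi>" by auto
    show "occurs12 R (plot n \<pi>)"
      unfolding occurs12_def
      using *(7) region_disjoint_iff[OF assms *(3-6) _ _ mem] *(1,2) mem
      by (intro bexI[OF _ mem(1)] bexI[OF _ mem(2)]) (simp add: order_inj_2)
  next
    assume "occurs12 R (plot n \<pi>)"
    then obtain x y where xy: "x \<in> plot n \<pi>" "y \<in> plot n \<pi>" "fst x < fst y" "snd x < snd y"
      "\<forall>z\<in>plot n \<pi>. z \<noteq> x \<longrightarrow> z \<noteq> y \<longrightarrow> (pos2 (fst x) (fst y) (fst z), pos2 (snd x) (snd y) (snd z)) \<notin> R"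
      unfolding occurs12_def by blast
    \<comment> \<open>The default \<open>n + 1\<close> supplies the boundary value at index
      3.\<close>
    define \<alpha> where "\<alpha> = (\<lambda>_ :: nat. n + 1)(0 := 0, 1 := fst x, 2 := fst y)"
    define \<beta> where "\<beta> = (\<lambda>_ :: nat. n + 1)(0 := 0, 1 := snd x, 2 := snd y)"
    have \<alpha>: "\<alpha> 0 = 0" "\<alpha> 1 = fst x" "\<alpha> 2 = fst y" "\<alpha> 3 = n + 1"
      and \<beta>: "\<beta> 0 = 0" "\<beta> 1 = snd x" "\<beta> 2 = snd y" "\<beta> 3 = n + 1"
      by (simp_all add: \<alpha>_def \<beta>_def)
    have bd: "1 \<le> fst z \<and> fst z \<le> n \<and> 1 \<le> snd z \<and> snd z \<le> n" if "z \<in> plot n \<pi>" for z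
      using that permutes_in_image[OF assms(1), of "fst z"] by (auto simp: plot_def)
    have "occurrence (mesh_of [1, 2] R) n \<pi> {x, y}"
      unfolding occurrence_def
    proof (intro conjI exI)
      show "order_inj (plen (mesh_of [1, 2] R)) n \<alpha>" "order_inj (plen (mesh_of [1, 2] R)) n \<beta>"
        using xy bd[OF xy(1)] bd[OF xy(2)] order_inj_2[of n \<alpha>] order_inj_2[of n \<beta>]
        by (simp_all add: mesh_of_simps \<alpha> \<beta> del: One_nat_def)
      show "\<forall>(i, j)\<in>pmesh (mesh_of [1, 2] R). region \<alpha> \<beta> i j \<inter> plot n \<pi> = {}"
        unfolding mesh_of_simps
        by (subst region_disjoint_iff[OF assms \<alpha>(1,4) \<beta>(1,4) _ _ xy(1,2)])
          (use xy(3-5) in \<open>simp_all add: \<alpha> \<beta> del: One_nat_def\<close>)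
      show "{x, y} = {(\<alpha> i, \<beta> j) | i j. (i, j) \<in> plot (plen (mesh_of [1, 2] R)) (pperm (mesh_of [1, 2] R))}"
        unfolding mesh_of_simps plot_one_line occurrence_points by (simp add: \<alpha> \<beta> del: One_nat_def)
    qed (use xy(1,2) \<alpha> \<beta> in \<open>simp_all add: mesh_of_simps del: One_nat_def\<close>)
    then show "\<exists>\<omega>. occurrence (mesh_of [1, 2] R) n \<pi> \<omega>" by blast
  qed
  then show ?thesis by (simp add: avoids_def)
qed

lemma avoids_21_iff:
  assumes "\<pi> permutes {1..n}" "R \<subseteq> {0, 1, 2} \<times> {0, 1, 2}"
  shows "avoids n \<pi> (mesh_of [2, 1] R) \<longleftrightarrow> \<not> occurs21 R (plot n \<pi>)"
proof -
  have "(\<exists>\<omega>. occurrence (mesh_of [2, 1] R) n \<pi> \<omega>) \<longleftrightarrow> occurs21 R (plot n \<pi>)"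
  proof
    assume "\<exists>\<omega>. occurrence (mesh_of [2, 1] R) n \<pi> \<omega>"
    then obtain \<alpha> \<beta> where *: "order_inj 2 n \<alpha>" "order_inj 2 n \<beta>"
      "\<alpha> 0 = 0" "\<alpha> 3 = n + 1" "\<beta> 0 = 0" "\<beta> 3 = n + 1"
      "\<forall>(i, j)\<in>R. region \<alpha> \<beta> i j \<inter> plot n \<pi> = {}"
      "(\<lambda>(i, j). (\<alpha> i, \<beta> j)) ` {(1, 2), (2, 1)} \<subseteq> plot n \<pi>"
      unfolding occurrence_def mesh_of_simps plot_one_line occurrence_points by auto
    then have mem: "(\<alpha> 1, \<beta> 2) \<in> plot n \<pi>" "(\<alpha> 2, \<beta> 1) \<in> plot n \<pi>" by auto
    show "occurs21 R (plot n \<pi>)"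
      unfolding occurs21_def
      using *(7) region_disjoint_iff[OF assms *(3-6) _ _ mem] *(1,2) mem
      by (intro bexI[OF _ mem(1)] bexI[OF _ mem(2)]) (simp add: order_inj_2 insert_commute)
  next
    assume "occurs21 R (plot n \<pi>)"
    then obtain x y where xy: "x \<in> plot n \<pi>" "y \<in> plot n \<pi>" "fst x < fst y" "snd y < snd x"
      "\<forall>z\<in>plot n \<pi>. z \<noteq> x \<longrightarrow> z \<noteq> y \<longrightarrow> (pos2 (fst x) (fst y) (fst z), pos2 (snd y) (snd x) (snd z)) \<notin> R"
      unfolding occurs21_def by blast
    define \<alpha> where "\<alpha> = (\<lambda>_ :: nat. n + 1)(0 := 0, 1 := fst x, 2 := fst y)"
    define \<beta> where "\<beta> = (\<lambda>_ :: nat. n + 1)(0 := 0, 1 := snd y, 2 := snd x)"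
    have \<alpha>: "\<alpha> 0 = 0" "\<alpha> 1 = fst x" "\<alpha> 2 = fst y" "\<alpha> 3 = n + 1"
      and \<beta>: "\<beta> 0 = 0" "\<beta> 1 = snd y" "\<beta> 2 = snd x" "\<beta> 3 = n + 1"
      by (simp_all add: \<alpha>_def \<beta>_def)
    have bd: "1 \<le> fst z \<and> fst z \<le> n \<and> 1 \<le> snd z \<and> snd z \<le> n" if "z \<in> plot n \<pi>" for z
      using that permutes_in_image[OF assms(1), of "fst z"] by (auto simp: plot_def)
    have "occurrence (mesh_of [2, 1] R) n \<pi> {x, y}"
      unfolding occurrence_def
    proof (intro conjI exI)
      show "order_inj (plen (mesh_of [2, 1] R)) n \<alpha>" "order_inj (plen (mesh_of [2, 1] R)) n \<beta>"
        using xy bd[OF xy(1)] bd[OF xy(2)] order_inj_2[of n \<alpha>] order_inj_2[of n \<beta>]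
        by (simp_all add: mesh_of_simps \<alpha> \<beta> del: One_nat_def)
      show "\<forall>(i, j)\<in>pmesh (mesh_of [2, 1] R). region \<alpha> \<beta> i j \<inter> plot n \<pi> = {}"
        unfolding mesh_of_simps
        by (subst region_disjoint_iff[OF assms \<alpha>(1,4) \<beta>(1,4) _ _ xy(1,2)])
          (use xy(3-5) in \<open>simp_all add: \<alpha> \<beta> insert_commute del: One_nat_def\<close>)
      show "{x, y} = {(\<alpha> i, \<beta> j) | i j. (i, j) \<in> plot (plen (mesh_of [2, 1] R)) (pperm (mesh_of [2, 1] R))}"
        unfolding mesh_of_simps plot_one_line occurrence_points by (simp add: \<alpha> \<beta> del: One_nat_def)
    qed (use xy(1,2) \<alpha> \<beta> in \<open>simp_all add: mesh_of_simps del: One_nat_def\<close>)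
    then show "\<exists>\<omega>. occurrence (mesh_of [2, 1] R) n \<pi> \<omega>" by blast
  qed
  then show ?thesis by (simp add: avoids_def)
qed

lemma avoids_231_iff:
  assumes "\<pi> permutes {1..n}"
  shows "avoids n \<pi> (classical [2, 3, 1]) \<longleftrightarrow> avoids231 n \<pi>"
proof -
  have "(\<exists>\<omega>. occurrence (classical [2, 3, 1]) n \<pi> \<omega>) \<longleftrightarrow>
    (\<exists>i j k. 1 \<le> i \<and> i < j \<and> j < k \<and> k \<le> n \<and> \<pi> k < \<pi> i \<and> \<pi> i < \<pi> j)"
  proof
    assume "\<exists>\<omega>. occurrence (classical [2, 3, 1]) n \<pi> \<omega>"
    then obtain \<alpha> \<beta> where *: "order_inj 3 n \<alpha>" "order_inj 3 n \<beta>"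
      "(\<lambda>(i, j). (\<alpha> i, \<beta> j)) ` {(1, 2), (2, 3), (3, 1)} \<subseteq> plot n \<pi>"
      unfolding occurrence_def classical_def mesh_of_simps plot_one_line occurrence_points by auto
    then have "\<beta> 2 = \<pi> (\<alpha> 1)" "\<beta> 3 = \<pi> (\<alpha> 2)" "\<beta> 1 = \<pi> (\<alpha> 3)" by (auto simp: plot_def)
    then show "\<exists>i j k. 1 \<le> i \<and> i < j \<and> j < k \<and> k \<le> n \<and> \<pi> k < \<pi> i \<and> \<pi> i < \<pi> j"
      using *(1,2) unfolding order_inj_3
      by (intro exI[of _ "\<alpha> 1"] exI[of _ "\<alpha> 2"] exI[of _ "\<alpha> 3"]) simp
  next
    assume "\<exists>i j k. 1 \<le> i \<and> i < j \<and> j < k \<and> k \<le> n \<and> \<pi> k < \<pi> i \<and> \<pi> i < \<pi> j"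
    then obtain i j k where ijk: "1 \<le> i" "i < j" "j < k" "k \<le> n" "\<pi> k < \<pi> i" "\<pi> i < \<pi> j" by blast
    define \<alpha> where "\<alpha> = (\<lambda>_ :: nat. n + 1)(0 := 0, 1 := i, 2 := j, 3 := k)"
    define \<beta> where "\<beta> = (\<lambda>_ :: nat. n + 1)(0 := 0, 1 := \<pi> k, 2 := \<pi> i, 3 := \<pi> j)"
    have \<alpha>: "\<alpha> 0 = 0" "\<alpha> 1 = i" "\<alpha> 2 = j" "\<alpha> 3 = k" "\<alpha> (3 + 1) = n + 1"
      and \<beta>: "\<beta> 0 = 0" "\<beta> 1 = \<pi> k" "\<beta> 2 = \<pi> i" "\<beta> 3 = \<pi> j" "\<beta> (3 + 1) = n + 1"
      by (simp_all add: \<alpha>_def \<beta>_def)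
    have "1 \<le> \<pi> k" "\<pi> j \<le> n"
      using permutes_in_image[OF assms, of k] permutes_in_image[OF assms, of j] ijk by auto
    then have inj: "order_inj 3 n \<alpha>" "order_inj 3 n \<beta>"
      unfolding order_inj_3 \<alpha> \<beta> using ijk by auto
    have mem: "{(i, \<pi> i), (j, \<pi> j), (k, \<pi> k)} \<subseteq> plot n \<pi>"
      using ijk by (auto simp: plot_def)
    have "{(i, \<pi> i), (j, \<pi> j), (k, \<pi> k)} = (\<lambda>(i, j). (\<alpha> i, \<beta> j)) ` {(1, 2), (2, 3), (3, 1)}"
      by (simp add: \<alpha> \<beta> del: One_nat_def)
    then have "occurrence (classical [2, 3, 1]) n \<pi> {(i, \<pi> i), (j, \<pi> j), (k, \<pi> k)}"
      unfolding occurrence_def classical_def mesh_of_simps plot_one_line occurrence_points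
      using inj mem \<alpha>(1,5) \<beta>(1,5) by blast
    then show "\<exists>\<omega>. occurrence (classical [2, 3, 1]) n \<pi> \<omega>" by blast
  qed
  then show ?thesis unfolding avoids_def avoids231_def by blast
qed

lemma bij_betw_perm_of: "bij_betw perm_of {t. size t = n} (Av n {classical [2, 3, 1]})"
  unfolding bij_betw_def
proof
  show "inj_on perm_of {t. size t = n}" by (rule inj_onI) (simp add: perm_of_inj)
  show "perm_of ` {t. size t = n} = Av n {classical [2, 3, 1]}"
  proof (intro equalityI subsetI)
    fix \<pi> assume "\<pi> \<in> perm_of ` {t. size t = n}"
    then obtain t where "size t = n" "\<pi> = perm_of t" by blast
    then show "\<pi> \<in> Av n {classical [2, 3, 1]}"
      using perm_of_permutes[of t] perm_of_avoids231[of t] avoids_231_iff by (simp add: Av_def)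
  next
    fix \<pi> assume "\<pi> \<in> Av n {classical [2, 3, 1]}"
    then have "\<pi> permutes {1..n}" "avoids231 n \<pi>" using avoids_231_iff by (auto simp: Av_def)
    then show "\<pi> \<in> perm_of ` {t. size t = n}" using perm_of_surj by force
  qed
qed

lemma card_Av:
  assumes "\<And>t. size t = n \<Longrightarrow> avoids n (perm_of t) p \<longleftrightarrow> P t"
  shows "int (card (Av n {classical [2, 3, 1], p})) = gf P $ n"
proof -
  have "Av n {classical [2, 3, 1], p} = perm_of ` {t. size t = n \<and> P t}"
  proof -
    have "Av n {classical [2, 3, 1], p} = {\<pi> \<in> Av n {classical [2, 3, 1]}. avoids n \<pi> p}"
      by (auto simp: Av_def)
    also have "\<dots> = perm_of ` {t. size t = n \<and> P t}"
      unfolding bij_betw_imp_surj_on[OF bij_betw_perm_of, symmetric] using assms by auto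
    finally show ?thesis .
  qed
  moreover have "inj_on perm_of {t. size t = n \<and> P t}"
    by (rule inj_onI) (simp add: perm_of_inj)
  ultimately show ?thesis by (simp add: card_image gf_nth)
qed

lemma card_Av_12:
  assumes "R \<subseteq> {0, 1, 2} \<times> {0, 1, 2}"
  shows "int (card (Av n {classical [2, 3, 1], mesh_of [1, 2] R})) =
    V12 ((0, 2) \<in> R) ((2, 2) \<in> R) ((0, 0) \<in> R) (Y_of R) (E_of R) $ n"
  unfolding V12_def
proof (rule card_Av)
  fix t :: btree assume t: "size t = n"
  show "avoids n (perm_of t) (mesh_of [1, 2] R) \<longleftrightarrow>
      \<not> contains12 ((0, 2) \<in> R) ((2, 2) \<in> R) ((0, 0) \<in> R) (Y_of R) (E_of R) t"
    using avoids_12_iff[OF perm_of_permutes assms, of t] by (simp add: t[symmetric] plot_perm_of occurs12_points)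
qed

lemma card_Av_21:
  assumes "R \<subseteq> {0, 1, 2} \<times> {0, 1, 2}"
  shows "int (card (Av n {classical [2, 3, 1], mesh_of [2, 1] R})) =
    V21 ((0, 2) \<in> R) ((2, 2) \<in> R) ((0, 0) \<in> R) (Z_of R) $ n"
  unfolding V21_def
proof (rule card_Av)
  fix t :: btree assume t: "size t = n"
  show "avoids n (perm_of t) (mesh_of [2, 1] R) \<longleftrightarrow>
      \<not> contains21 ((0, 2) \<in> R) ((2, 2) \<in> R) ((0, 0) \<in> R) (Z_of R) t"
    using avoids_21_iff[OF perm_of_permutes assms, of t] by (simp add: t[symmetric] plot_perm_of occurs21_points)
qed

section \<open>The 23 classes\<close>

text \<open>In the case \<open>(1, 0) \<in> R\<close>, \<open>(0, 1) \<notin> R\<close> the lower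
  right quadrant is shaded and the upper left is not. Only shading both remaining quadrants gives
  \<open>nechain\<close> instead of \<open>nonempty\<close>; the empty tree completes these to
  \<open>chain\<close> and \<open>any\<close>.\<close>

lemma E_of_eq:
  "E_of R = (if (1, 0) \<notin> R \<or> (0, 1) \<notin> R \<and> \<not> ((0, 0) \<in> R \<and> (1, 1) \<in> R) then any
     else if (0, 1) \<notin> R then chain else empty)"
proof -
  have "t = Lf \<or> nechain t \<longleftrightarrow> chain t" for t by auto
  then show ?thesis
    by (cases "(1, 0) \<in> R"; cases "(0, 1) \<in> R"; cases "(0, 0) \<in> R"; cases "(1, 1) \<in> R")
      (simp_all add: E_of_def tree_occurs1_eqs fun_eq_iff)
qed

text \<open>As a list, its length bounds the cardinality from above. The order is that of the pairs
  of coefficients at 3 and 5.\<close>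

definition classes :: "int fps set" where
  "classes = set [
     D, M, V21 False False False single, 1 + X * C, K, C - X * (C - 1) * D,
     V21 True False False nechain, V12 False True True nechain any,
     V12 False True True nechain chain, V12 False False False has_trivial empty,
     V12 False False False first_trivial empty, 1 + H, C - X * (C - 1),
     V21 False True True has_trivial, V21 True False False single, C - X * X * C * D,
     C - X * X * D * D, V12 True False False has_trivial empty,
     V12 True False False first_trivial empty, C - X * H, C - X * X * C, C - X * X * D,
     C - X * X]"

lemma in_classes:
  "D \<in> classes"
  "M \<in> classes"
  "V21 False False False single \<in> classes"
  "1 + X * C \<in> classes"
  "K \<in> classes"
  "C - X * (C - 1) * D \<in> classes"
  "V21 True False False nechain \<in> classes"
  "V12 False True True nechain any \<in> classes"
  "V12 False True True nechain chain \<in> classes"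
  "V12 False False False has_trivial empty \<in> classes"
  "V12 False False False first_trivial empty \<in> classes"
  "1 + H \<in> classes"
  "C - X * (C - 1) \<in> classes"
  "V21 False True True has_trivial \<in> classes"
  "V21 True False False single \<in> classes"
  "C - X * X * C * D \<in> classes"
  "C - X * X * D * D \<in> classes"
  "V12 True False False has_trivial empty \<in> classes"
  "V12 True False False first_trivial empty \<in> classes"
  "C - X * H \<in> classes"
  "C - X * X * C \<in> classes"
  "C - X * X * D \<in> classes"
  "C - X * X \<in> classes"
  by (simp_all only: classes_def list.set insert_iff simp_thms)

text \<open>Eight Booleans describe the nine cells: a point in \<open>(2, 0)\<close> would form a
  231 with the occurrence, so that cell is always empty. The claim is a check of the 256
  cases.\<close>

lemma V12_in_classes:
  "V12 ((0, 2) \<in> R) ((2, 2) \<in> R) ((0, 0) \<in> R) (Y_of R) (E_of R) \<in> classes"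
proof -
  have "\<forall>a b d p q y u r. V12 a b d (tree_occurs1 y u r b)
      (if \<not> p \<or> \<not> q \<and> \<not> (d \<and> y) then any else if \<not> q then chain else empty) \<in> classes"
    by (simp only: all_bool_eq simp_thms if_True if_False tree_occurs1_eqs V12_unrestricted[of True]
      class_gf in_classes
      M_def[symmetric] K_def[symmetric])
  then show ?thesis unfolding E_of_eq Y_of_def by blast
qed

text \<open>Here a point in \<open>(0, 1)\<close> or \<open>(1, 2)\<close> would form a 231 with the
  occurrence, which leaves seven cells and 128 cases.\<close>

lemma V21_in_classes:
  "V21 ((0, 2) \<in> R) ((2, 2) \<in> R) ((0, 0) \<in> R) (Z_of R) \<in> classes"
proof -
  have "\<forall>a b d x y u r. V21 a b d (tree_occurs1 x y u r) \<in> classes"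
    by (simp only: all_bool_eq simp_thms tree_occurs1_eqs
      class_gf in_classes M_def[symmetric] K_def[symmetric])
  then show ?thesis unfolding Z_of_def by blast
qed

section \<open>Coefficients by listing all trees of size up to 5\<close>

definition nodes :: "btree list \<Rightarrow> btree list \<Rightarrow> btree list" where
  "nodes ls rs = concat (map (\<lambda>l. map (Nd l) rs) ls)"

definition "trees1 = nodes [Lf] [Lf]"
definition "trees2 = nodes [Lf] trees1 @ nodes trees1 [Lf]"
definition "trees3 = nodes [Lf] trees2 @ nodes trees1 trees1 @ nodes trees2 [Lf]"
definition "trees4 = nodes [Lf] trees3 @ nodes trees1 trees2 @ nodes trees2 trees1 @ nodes trees3 [Lf]"
definition "trees5 = nodes [Lf] trees4 @ nodes trees1 trees3 @ nodes trees2 trees2 @ nodes trees3 trees1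
  @ nodes trees4 [Lf]"

lemmas trees_simps = trees1_def trees2_def trees3_def trees4_def trees5_def nodes_def

lemma size_eq_Suc: "{t. size t = Suc n} = (\<Union>i\<in>{..n}. {Nd l r | l r. size l = i \<and> size r = n - i})"
proof
  show "{t. size t = Suc n} \<subseteq> (\<Union>i\<in>{..n}. {Nd l r | l r. size l = i \<and> size r = n - i})"
  proof
    fix t :: btree assume "t \<in> {t. size t = Suc n}"
    then show "t \<in> (\<Union>i\<in>{..n}. {Nd l r | l r. size l = i \<and> size r = n - i})"
      by (cases t) auto
  qed
qed auto

lemma set_nodes: "set (nodes ls rs) = {Nd l r | l r. l \<in> set ls \<and> r \<in> set rs}"
  by (auto simp: nodes_def)

lemma set_trees:
  "set [Lf] = {t. size t = 0}" "set trees1 = {t. size t = 1}" "set trees2 = {t. size t = 2}"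
  "set trees3 = {t. size t = 3}" "set trees4 = {t. size t = 4}" "set trees5 = {t. size t = 5}"
proof -
  have split: "{..0} = {0::nat}" "{..1} = {0, 1::nat}" "{..2} = {0, 1, 2::nat}" "{..3} = {0, 1, 2, 3::nat}"
    "{..4} = {0, 1, 2, 3, 4::nat}" by auto
  have node: "set (nodes ls rs) = {Nd l r | l r. size l = i \<and> size r = j}"
    if "set ls = {t. size t = i}" "set rs = {t. size t = j}" for ls rs i j
    using that by (simp add: set_nodes)
  show 0: "set [Lf] = {t. size t = 0}" by (auto simp: size_eq_0_iff)
  show 1: "set trees1 = {t. size t = 1}"
    using size_eq_Suc[of 0] unfolding split trees1_def by (simp add: node[OF 0 0])
  show 2: "set trees2 = {t. size t = 2}"
    using size_eq_Suc[of 1] unfolding split trees2_def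
    by (simp add: node[OF 0 1] node[OF 1 0] numeral_2_eq_2)
  show 3: "set trees3 = {t. size t = 3}"
    using size_eq_Suc[of 2] unfolding split trees3_def
    by (simp add: node[OF 0 2] node[OF 1 1] node[OF 2 0])
  show 4: "set trees4 = {t. size t = 4}"
    using size_eq_Suc[of 3] unfolding split trees4_def
    by (simp add: node[OF 0 3] node[OF 1 2] node[OF 2 1] node[OF 3 0])
  show 5: "set trees5 = {t. size t = 5}"
    using size_eq_Suc[of 4] unfolding split trees5_def
    by (simp add: node[OF 0 4] node[OF 1 3] node[OF 2 2] node[OF 3 1] node[OF 4 0])
qed

text \<open>Reduces a coefficient to filtering an explicit list, which \<open>code_simp\<close> can
  evaluate.\<close>

lemma gf_nth_trees:
  "gf P $ 3 = int (length (filter P trees3))" "gf P $ 5 = int (length (filter P trees5))"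
proof -
  have "distinct trees3" "distinct trees5" by (simp_all add: trees_simps)
  then show "gf P $ 3 = int (length (filter P trees3))" "gf P $ 5 = int (length (filter P trees5))"
    using set_trees by (simp_all add: gf_nth flip: distinct_card)
qed

definition avoider_gf :: "mesh_pattern \<Rightarrow> int fps" where
  "avoider_gf p = Abs_fps (\<lambda>n. int (card (Av n {classical [2, 3, 1], p})))"

lemma avoider_gf_12: "R \<subseteq> {0, 1, 2} \<times> {0, 1, 2} \<Longrightarrow> avoider_gf (mesh_of [1, 2] R) =
    V12 ((0, 2) \<in> R) ((2, 2) \<in> R) ((0, 0) \<in> R) (Y_of R) (E_of R)"
  by (rule fps_ext) (simp only: avoider_gf_def fps_nth_Abs_fps card_Av_12)

lemma avoider_gf_21: "R \<subseteq> {0, 1, 2} \<times> {0, 1, 2} \<Longrightarrow> avoider_gf (mesh_of [2, 1] R) =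
    V21 ((0, 2) \<in> R) ((2, 2) \<in> R) ((0, 0) \<in> R) (Z_of R)"
  by (rule fps_ext) (simp only: avoider_gf_def fps_nth_Abs_fps card_Av_21)

text \<open>One mesh for each member of \<open>classes\<close>, so that none of the 23 series is
  missed by the patterns.\<close>

lemma avoider_gf_reps:
  "avoider_gf (mesh_of [1, 2] {}) = D"
  "avoider_gf (mesh_of [1, 2] {(0, 1), (1, 0)}) = M"
  "avoider_gf (mesh_of [2, 1] {(1, 0), (2, 0), (2, 1)}) = V21 False False False single"
  "avoider_gf (mesh_of [1, 2] {(0, 2)}) = 1 + X * C"
  "avoider_gf (mesh_of [2, 1] {(0, 2), (1, 0), (2, 1)}) = K"
  "avoider_gf (mesh_of [1, 2] {(0, 0), (1, 1), (2, 2)}) = C - X * (C - 1) * D"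
  "avoider_gf (mesh_of [2, 1] {(0, 2), (1, 0), (2, 0), (2, 1)}) = V21 True False False nechain"
  "avoider_gf (mesh_of [1, 2] {(0, 0), (1, 0), (1, 1), (2, 2)}) = V12 False True True nechain any"
  "avoider_gf (mesh_of [1, 2] {(0, 0), (1, 0), (1, 1), (2, 1), (2, 2)}) = V12 False True True nechain chain"
  "avoider_gf (mesh_of [1, 2] {(0, 1), (1, 0), (1, 2), (2, 1)}) = V12 False False False has_trivial empty"
  "avoider_gf (mesh_of [1, 2] {(0, 1), (1, 0), (1, 1), (1, 2), (2, 1)}) = V12 False False False first_trivial empty"
  "avoider_gf (mesh_of [1, 2] {(0, 1), (0, 2), (1, 0)}) = 1 + H"
  "avoider_gf (mesh_of [2, 1] {(0, 0), (2, 2)}) = C - X * (C - 1)"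
  "avoider_gf (mesh_of [2, 1] {(0, 0), (1, 1), (2, 0), (2, 2)}) = V21 False True True has_trivial"
  "avoider_gf (mesh_of [2, 1] {(0, 2), (1, 0), (1, 1), (2, 0), (2, 1)}) = V21 True False False single"
  "avoider_gf (mesh_of [1, 2] {(0, 0), (0, 1), (1, 0), (1, 1), (2, 2)}) = C - X * X * C * D"
  "avoider_gf (mesh_of [1, 2] {(0, 0), (0, 1), (1, 0), (1, 1), (2, 1), (2, 2)}) = C - X * X * D * D"
  "avoider_gf (mesh_of [1, 2] {(0, 1), (0, 2), (1, 0), (1, 2), (2, 1)}) = V12 True False False has_trivial empty"
  "avoider_gf (mesh_of [1, 2] {(0, 1), (0, 2), (1, 0), (1, 1), (1, 2), (2, 1)}) = V12 True False False first_trivial empty"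
  "avoider_gf (mesh_of [2, 1] {(0, 0), (0, 2), (1, 1), (2, 0), (2, 2)}) = C - X * H"
  "avoider_gf (mesh_of [2, 1] {(0, 0), (1, 0), (2, 1), (2, 2)}) = C - X * X * C"
  "avoider_gf (mesh_of [2, 1] {(0, 0), (1, 0), (2, 0), (2, 1), (2, 2)}) = C - X * X * D"
  "avoider_gf (mesh_of [2, 1] {(0, 0), (0, 2), (1, 0), (1, 1), (2, 0), (2, 1), (2, 2)}) = C - X * X"
  by (simp_all add: avoider_gf_12 avoider_gf_21 Y_of_def Z_of_def E_of_eq tree_occurs1_eqs V12_unrestricted[of True] class_gf
      del: One_nat_def flip: M_def K_def)

named_theorems class_coeffs

lemma [class_coeffs]: "D $ 3 = 1" "D $ 5 = 1"
  \<comment> \<open>The closed form is traded back for a predicate with that series, since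
    coefficients are found by counting trees.\<close>
  unfolding V21_TFF_nonempty[symmetric] V12_def V21_def gf_nth_trees by code_simp+

lemma [class_coeffs]: "M $ 3 = 2" "M $ 5 = 9"
  unfolding M_def V12_def V21_def gf_nth_trees by code_simp+

lemma [class_coeffs]:
  "(V21 False False False single) $ 3 = 2"
  "(V21 False False False single) $ 5 = 13"
  unfolding V12_def V21_def gf_nth_trees by code_simp+

lemma [class_coeffs]: "(1 + X * C) $ 3 = 2" "(1 + X * C) $ 5 = 14"
  unfolding V12_TFT_nonempty_any[symmetric] V12_def V21_def gf_nth_trees by code_simp+

lemma [class_coeffs]: "K $ 3 = 2" "K $ 5 = 19"
  unfolding K_def V12_def V21_def gf_nth_trees by code_simp+

lemma [class_coeffs]: "(C - X * (C - 1) * D) $ 3 = 2" "(C - X * (C - 1) * D) $ 5 = 20"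
  unfolding V12_TFT_nonempty_chain[symmetric] V12_def V21_def gf_nth_trees by code_simp+

lemma [class_coeffs]:
  "(V21 True False False nechain) $ 3 = 2"
  "(V21 True False False nechain) $ 5 = 25"
  unfolding V12_def V21_def gf_nth_trees by code_simp+

lemma [class_coeffs]:
  "(V12 False True True nechain any) $ 3 = 2"
  "(V12 False True True nechain any) $ 5 = 26"
  unfolding V12_def V21_def gf_nth_trees by code_simp+

lemma [class_coeffs]:
  "(V12 False True True nechain chain) $ 3 = 2"
  "(V12 False True True nechain chain) $ 5 = 32"
  unfolding V12_def V21_def gf_nth_trees by code_simp+

lemma [class_coeffs]:
  "(V12 False False False has_trivial empty) $ 3 = 3"
  "(V12 False False False has_trivial empty) $ 5 = 17"
  unfolding V12_def V21_def gf_nth_trees by code_simp+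

lemma [class_coeffs]:
  "(V12 False False False first_trivial empty) $ 3 = 3"
  "(V12 False False False first_trivial empty) $ 5 = 19"
  unfolding V12_def V21_def gf_nth_trees by code_simp+

lemma [class_coeffs]: "(1 + H) $ 3 = 3" "(1 + H) $ 5 = 24"
  unfolding V12_TFT_has_any[symmetric] V12_def V21_def gf_nth_trees by code_simp+

lemma [class_coeffs]: "(C - X * (C - 1)) $ 3 = 3" "(C - X * (C - 1)) $ 5 = 28"
  unfolding V12_TFT_nonempty_empty[symmetric] V12_def V21_def gf_nth_trees by code_simp+

lemma [class_coeffs]:
  "(V21 False True True has_trivial) $ 3 = 3"
  "(V21 False True True has_trivial) $ 5 = 29"
  unfolding V12_def V21_def gf_nth_trees by code_simp+

lemma [class_coeffs]:
  "(V21 True False False single) $ 3 = 3"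
  "(V21 True False False single) $ 5 = 31"
  unfolding V12_def V21_def gf_nth_trees by code_simp+

lemma [class_coeffs]: "(C - X * X * C * D) $ 3 = 3" "(C - X * X * C * D) $ 5 = 33"
  unfolding V12_TFT_indec_chain[symmetric] V12_def V21_def gf_nth_trees by code_simp+

lemma [class_coeffs]: "(C - X * X * D * D) $ 3 = 3" "(C - X * X * D * D) $ 5 = 38"
  unfolding V12_TFT_nechain_chain[symmetric] V12_def V21_def gf_nth_trees by code_simp+

lemma [class_coeffs]:
  "(V12 True False False has_trivial empty) $ 3 = 4"
  "(V12 True False False has_trivial empty) $ 5 = 31"
  unfolding V12_def V21_def gf_nth_trees by code_simp+

lemma [class_coeffs]:
  "(V12 True False False first_trivial empty) $ 3 = 4"
  "(V12 True False False first_trivial empty) $ 5 = 33"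
  unfolding V12_def V21_def gf_nth_trees by code_simp+

lemma [class_coeffs]: "(C - X * H) $ 3 = 4" "(C - X * H) $ 5 = 34"
  unfolding V12_TFT_has_empty[symmetric] V12_def V21_def gf_nth_trees by code_simp+

lemma [class_coeffs]: "(C - X * X * C) $ 3 = 4" "(C - X * X * C) $ 5 = 37"
  unfolding V12_TFT_indec_empty[symmetric] V12_def V21_def gf_nth_trees by code_simp+

lemma [class_coeffs]: "(C - X * X * D) $ 3 = 4" "(C - X * X * D) $ 5 = 41"
  unfolding V12_TFT_nechain_empty[symmetric] V12_def V21_def gf_nth_trees by code_simp+

lemma [class_coeffs]: "(C - X * X) $ 3 = 5" "(C - X * X) $ 5 = 42"
  unfolding V12_TFT_single_empty[symmetric] V12_def V21_def gf_nth_trees by code_simp+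

text \<open>Length 5 alone would leave ties at 19, 31 and 33; the count at length 3 breaks
  them.\<close>

lemma card_classes: "card classes = 23"
proof (rule antisym)
  show "card classes \<le> 23"
    unfolding classes_def by (rule order.trans[OF card_length]) simp
  have "(\<lambda>f. (f $ 3, f $ 5)) ` classes = {
      (1, 1), (2, 9), (2, 13), (2, 14), (2, 19), (2, 20), (2, 25), (2, 26), (2, 32), (3, 17),
      (3, 19), (3, 24), (3, 28), (3, 29), (3, 31), (3, 33), (3, 38), (4, 31), (4, 33), (4, 34),
      (4, 37), (4, 41), (5, 42)}"
    unfolding classes_def by (simp only: list.set image_insert image_empty class_coeffs)
  moreover have "card {
      (1, 1), (2, 9), (2, 13), (2, 14), (2, 19), (2, 20), (2, 25), (2, 26), (2, 32), (3, 17),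
      (3, 19), (3, 24), (3, 28), (3, 29), (3, 31), (3, 33), (3, 38), (4, 31), (4, 33), (4, 34),
      (4, 37), (4, 41), (5, 42) :: int \<times> int} = 23"
    by simp
  ultimately show "23 \<le> card classes"
    using card_image_le[of classes "\<lambda>f. (f $ 3, f $ 5)"] by (simp add: classes_def)
qed

lemma avoider_gf_image: "avoider_gf ` mesh_patterns 2 = classes"
proof
  show "avoider_gf ` mesh_patterns 2 \<subseteq> classes"
    unfolding mesh_patterns_two
    using avoider_gf_12 V12_in_classes avoider_gf_21 V21_in_classes by auto
  have mem: "mesh_of [1, 2] R \<in> mesh_patterns 2" "mesh_of [2, 1] R \<in> mesh_patterns 2"
    if "R \<subseteq> {0, 1, 2} \<times> {0, 1, 2}" for R
    unfolding mesh_patterns_two using that by blast+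
  show "classes \<subseteq> avoider_gf ` mesh_patterns 2"
    unfolding classes_def list.set insert_subset
    by (intro conjI empty_subsetI; rule image_eqI, rule avoider_gf_reps[symmetric], rule mem, simp)
qed

text \<open>The classes of the kernel of \<open>f\<close> on \<open>A\<close> are the nonempty
  fibres of \<open>f\<close>, one for each value attained.\<close>

lemma card_quotient_fibres:
  "card (A // {(x, y). x \<in> A \<and> y \<in> A \<and> f x = f y}) = card (f ` A)"
proof -
  let ?r = "{(x, y). x \<in> A \<and> y \<in> A \<and> f x = f y}"
  have "?r `` {x} = {y \<in> A. f y = f x}" if "x \<in> A" for x
    using that by auto
  then have "A // ?r = (\<lambda>c. {y \<in> A. f y = c}) ` (f ` A)"
    by (simp add: quotient_def UNION_singleton_eq_range image_image cong: image_cong_simp)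
  moreover have "inj_on (\<lambda>c. {y \<in> A. f y = c}) (f ` A)"
    by (rule inj_onI) auto
  ultimately show ?thesis by (simp add: card_image)
qed

theorem mainTheorem8:
  shows "card (mesh_patterns 2 // wilf_under (classical [2, 3, 1]) (mesh_patterns 2)) = 23"
proof -
  have "avoider_gf p = avoider_gf q \<longleftrightarrow>
      (\<forall>n. card (Av n {classical [2, 3, 1], p}) = card (Av n {classical [2, 3, 1], q}))" for p q
    by (simp add: avoider_gf_def fps_eq_iff)
  then have "wilf_under (classical [2, 3, 1]) (mesh_patterns 2) =
      {(p, q). p \<in> mesh_patterns 2 \<and> q \<in> mesh_patterns 2 \<and> avoider_gf p = avoider_gf q}"
    by (simp only: wilf_under_def)
  then show ?thesis
    by (simp only: card_quotient_fibres avoider_gf_image card_classes)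
qed

end
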